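(* Let $q$ be a prime power and let $0\le r\le n$ be integers with $n\ge 1$. Let $\mathrm{psd}_1(n,r)$ be the number of positive semidefinite matrices of type 1 in $M_n(\mathbb{F}_q)$ having rank $r$. Then $$\mathrm{psd}_1(n,r)=\begin{cases}\displaystyle \genfrac{[}{]}{0pt}{}{n}{r}_q\, q^{\frac{r(r-1)}{2}}\left(\frac{q-1}{2}\right)^r & \text{if } q \text{ is odd},\\[1em] \displaystyle \genfrac{[}{]}{0pt}{}{n}{r}_q\, q^{\frac{r(r-1)}{2}}(q-1)^r & \text{if } q \text{ is even}.\end{cases}$$
   Context: An element $a\in\mathbb{F}_q^\times$ is positive if $a=b^2$ for some $b\in\mathbb{F}_q^\times$. For $A\in M_n(\mathbb{F}_q)$ and $K\subseteq[n]=\{1,\dots,n\}$, $A_K$ is the principal submatrix with rows and columns indexed by $K$ (in increasing order). A symmetric invertible matrix over $\mathbb{F}_q$ is $\mathrm{PD}_1$ (positive definite of type 1) if all its leading principal minors are positive; the empty matrix is regarded as $\mathrm{PD}_1$. A symmetric matrix $A\in M_n(\mathbb{F}_q)$ is positive semidefinite of type 1 if for each $m\in[n]$ there exists a subset $K_m\subseteq[m]$ such that $A_{K_m}$ is $\mathrm{PD}_1$ and $A_M$ is singular for every $M\subseteq[m]$ with $|M|>|K_m|$. $\genfrac{[}{]}{0pt}{}{n}{r}_q=\prod_{i=0}^{r-1}\frac{q^{n-i}-1}{q^{r-i}-1}$ is the Gaussian ($q$-)binomial coefficient. *)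

theory Defs
  imports
    "HOL-Library.Cardinality"
    Jordan_Normal_Form.Determinant
    Jordan_Normal_Form.DL_Rank
    Jordan_Normal_Form.DL_Submatrix
begin

text \<open>
  The field with \<open>q\<close> elements is a type of class \<open>{field, finite}\<close>. Matrices are indexed from 0,
  so \<open>[m] = {1, ..., m}\<close> is rendered as \<open>{..<m}\<close>.
\<close>

definition positive_elem :: "'a::field \<Rightarrow> bool" where
  "positive_elem a \<longleftrightarrow> (\<exists>b. b \<noteq> 0 \<and> a = b ^ 2)"

text \<open>\<open>submatrix\<close> lists the selected rows and columns in increasing order.\<close>

definition principal_submatrix :: "'a mat \<Rightarrow> nat set \<Rightarrow> 'a mat" where
  "principal_submatrix A K = submatrix A K K"

text \<open>
  The equation \<open>A\<^sup>T = A\<close> below also forces \<open>A\<close> to be square. The \<open>0 \<times> 0\<close> matrix is invertible in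
  the library and hence satisfies \<open>pd1\<close>, as it should by convention.
\<close>

definition pd1 :: "'a::field mat \<Rightarrow> bool" where
  "pd1 A \<longleftrightarrow> transpose_mat A = A \<and> invertible_mat A \<and>
     (\<forall>k\<in>{1..dim_row A}. positive_elem (det (principal_submatrix A {..<k})))"

definition psd1 :: "'a::field mat \<Rightarrow> bool" where
  "psd1 A \<longleftrightarrow> transpose_mat A = A \<and>
     (\<forall>m\<in>{1..dim_row A}. \<exists>K\<subseteq>{..<m}. pd1 (principal_submatrix A K) \<and>
        (\<forall>M\<subseteq>{..<m}. card M > card K \<longrightarrow> \<not> invertible_mat (principal_submatrix A M)))"

definition gaussian_binomial :: "nat \<Rightarrow> nat \<Rightarrow> nat \<Rightarrow> rat" where
  "gaussian_binomial q n r =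
     (\<Prod>i<r. (of_nat q ^ (n - i) - 1) / (of_nat q ^ (r - i) - 1))"

text \<open>The number of type-1 positive semidefinite \<open>n \<times> n\<close> matrices of rank \<open>r\<close> over \<open>'a\<close>.\<close>

definition psd1_count :: "'a::{field,finite} itself \<Rightarrow> nat \<Rightarrow> nat \<Rightarrow> nat" where
  "psd1_count _ n r =
     card {A :: 'a mat. A \<in> carrier_mat n n \<and> psd1 A \<and> vec_space.rank n A = r}"

end

(* Border a symmetric n x n matrix B by a column v and a corner entry a. If the bordered matrix is
   positive semidefinite, so is B, and v = B w for some w, since otherwise the rank would increase
   by two whereas a PD_1 principal submatrix loses at most one row when the last index is dropped.
   For v = B w, congruence turns the bordered matrix into diag(B, a - w . v): the rank is unchanged
   if a = w . v, and otherwise it grows by one and the condition is that a - w . v be positive.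
   With p positive elements in the field, a matrix B of rank s thus has q^s extensions of rank s
   and q^s p extensions of rank s + 1, and the resulting recursion is Pascal's rule for the
   Gaussian binomial coefficients. Ranks are handled by counting: the range of a matrix of rank r
   has q^r elements. *)

theory Submission
  imports Defs
begin

text \<open>The maximality clause in \<open>psd1\<close> speaks of invertible principal submatrices,
  not of rank. What links the two is symmetry: the indices of a column basis of a symmetric matrix
  also select an invertible principal submatrix. Hence each clause says that some PD_1 block has
  size equal to the rank of a leading block, and one more row and column adds a single clause.
  Diagonalizing quadratic forms would set characteristic 2 apart. Bordering does not: it uses only
  that the nonzero squares form a group, so that the determinant of a PD_1 block cancels from the
  condition on the corner entry. The characteristic enters only through the number of nonzero
  squares. Blocks on an index set \<open>K\<close> are treated as maps on full-length vectors
  supported on \<open>K\<close>, so that blocks for different index sets can be compared without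
  renumbering.\<close>

section \<open>Vectors with prescribed support\<close>

definition supp_vecs :: "nat \<Rightarrow> nat set \<Rightarrow> 'a::zero vec set" where
  "supp_vecs n K = {x \<in> carrier_vec n. \<forall>i<n. i \<notin> K \<longrightarrow> x $ i = 0}"

definition mat_range :: "'a::semiring_0 mat \<Rightarrow> 'a vec set" where
  "mat_range A = (*\<^sub>v) A ` carrier_vec (dim_col A)"

lemma supp_vecs_carrier: "x \<in> supp_vecs n K \<Longrightarrow> x \<in> carrier_vec n"
  by (simp add: supp_vecs_def)

lemma supp_vecs_full: "supp_vecs n {..<n} = carrier_vec n"
  by (auto simp: supp_vecs_def)

lemma zero_in_supp_vecs [simp]: "0\<^sub>v n \<in> supp_vecs n K"
  by (simp add: supp_vecs_def)

lemma supp_vecs_minus: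
  fixes x y :: "'a::ring vec"
  shows "x \<in> supp_vecs n K \<Longrightarrow> y \<in> supp_vecs n K \<Longrightarrow> x - y \<in> supp_vecs n K"
  by (auto simp: supp_vecs_def)

lemma card_supp_vecs:
  assumes "K \<subseteq> {..<n}"
  shows "card (supp_vecs n K :: 'a::{zero,finite} vec set) = CARD('a) ^ card K"
proof -
  let ?f = "\<lambda>g. vec n (\<lambda>i. if i \<in> K then g i else (0::'a))"
  have fin: "finite K"
    using assms finite_subset by blast
  have "bij_betw ?f (K \<rightarrow>\<^sub>E UNIV) (supp_vecs n K)"
  proof (rule bij_betwI[where g = "\<lambda>x. restrict (vec_index x) K"])
    show "?f \<in> (K \<rightarrow>\<^sub>E UNIV) \<rightarrow> supp_vecs n K"
      by (auto simp: supp_vecs_def)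
  next
    fix g :: "nat \<Rightarrow> 'a" assume "g \<in> K \<rightarrow>\<^sub>E UNIV"
    then show "restrict (vec_index (?f g)) K = g"
      using assms by (auto simp: fun_eq_iff PiE_def extensional_def)
  qed (auto simp: supp_vecs_def)
  then have "card (supp_vecs n K :: 'a vec set) = card (K \<rightarrow>\<^sub>E (UNIV :: 'a set))"
    by (simp add: bij_betw_same_card)
  also have "\<dots> = CARD('a) ^ card K"
    using fin by (simp add: card_funcsetE)
  finally show ?thesis .
qed

lemma finite_carrier_vec: "finite (carrier_vec n :: 'a::{zero,finite} vec set)"
proof -
  have "card (carrier_vec n :: 'a vec set) > 0"
    using card_supp_vecs[of "{..<n}" n, where 'a='a] by (simp add: supp_vecs_full)
  then show ?thesis
    by (rule card_ge_0_finite)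
qed

lemma finite_supp_vecs: "finite (supp_vecs n K :: 'a::{zero,finite} vec set)"
  by (rule finite_subset[OF _ finite_carrier_vec[of n]]) (auto simp: supp_vecs_def)

lemma finite_mat_range: "finite (mat_range (A :: 'a::{semiring_0,finite} mat))"
  by (simp add: mat_range_def finite_carrier_vec)

lemma mult_mat_vec_minus:
  fixes A :: "'a::comm_ring mat"
  assumes "A \<in> carrier_mat m n" "x \<in> carrier_vec n" "y \<in> carrier_vec n"
  shows "A *\<^sub>v (x - y) = A *\<^sub>v x - A *\<^sub>v y"
  using assms by (intro eq_vecI) (auto simp: scalar_prod_minus_distrib[where n = n])

lemma vec_eq_iff_minus:
  fixes x y :: "'a::ab_group_add vec"
  assumes "x \<in> carrier_vec n" "y \<in> carrier_vec n"
  shows "x - y = 0\<^sub>v n \<longleftrightarrow> x = y"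
  using assms by (auto simp: vec_eq_iff)

lemma inj_on_mult_mat_vec_iff:
  fixes A :: "'a::comm_ring mat"
  assumes A: "A \<in> carrier_mat m n"
  shows "inj_on ((*\<^sub>v) A) (supp_vecs n K) \<longleftrightarrow>
    (\<forall>x\<in>supp_vecs n K. A *\<^sub>v x = 0\<^sub>v m \<longrightarrow> x = 0\<^sub>v n)"
proof (intro iffI ballI impI inj_onI)
  fix x assume "inj_on ((*\<^sub>v) A) (supp_vecs n K)" "x \<in> supp_vecs n K" "A *\<^sub>v x = 0\<^sub>v m"
  moreover have "A *\<^sub>v 0\<^sub>v n = 0\<^sub>v m"
    using A by auto
  ultimately show "x = 0\<^sub>v n"
    by (metis inj_onD zero_in_supp_vecs)
next
  fix x y
  assume ker: "\<forall>x\<in>supp_vecs n K. A *\<^sub>v x = 0\<^sub>v m \<longrightarrow> x = 0\<^sub>v n"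
    and xy: "x \<in> supp_vecs n K" "y \<in> supp_vecs n K" "A *\<^sub>v x = A *\<^sub>v y"
  have "A *\<^sub>v (x - y) = 0\<^sub>v m"
    using A xy by (subst mult_mat_vec_minus[OF A]) (auto simp: supp_vecs_carrier)
  then have "x - y = 0\<^sub>v n"
    using ker supp_vecs_minus[OF xy(1,2)] by blast
  then show "x = y"
    using vec_eq_iff_minus xy by (metis supp_vecs_carrier)
qed

section \<open>Column bases, and the rank as an exponent in the size of the range\<close>

text \<open>A support \<open>K\<close> minimal subject to \<open>A\<close> attaining its whole range on vectors supported in \<open>K\<close>
  indexes a column basis: a relation between these columns would allow one of them to be dropped.\<close>

lemma exists_column_basis:
  fixes A :: "'a::{field,finite} mat"
  assumes A: "A \<in> carrier_mat m n"
  obtains K where "K \<subseteq> {..<n}" "inj_on ((*\<^sub>v) A) (supp_vecs n K)" "(*\<^sub>v) A ` supp_vecs n K = mat_range A"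
proof -
  let ?P = "\<lambda>K. K \<subseteq> {..<n} \<and> (*\<^sub>v) A ` supp_vecs n K = mat_range A"
  have "?P {..<n}"
    using A by (auto simp: supp_vecs_full mat_range_def)
  then obtain K where K: "?P K" and min: "\<And>K'. ?P K' \<Longrightarrow> card K \<le> card K'"
    using ex_has_least_nat[of ?P _ card] by metis
  have kernel: "z = 0\<^sub>v n" if z: "z \<in> supp_vecs n K" and Az: "A *\<^sub>v z = 0\<^sub>v m" for z
  proof (rule ccontr)
    assume "z \<noteq> 0\<^sub>v n"
    then obtain j where j: "j < n" "z $ j \<noteq> 0"
      using supp_vecs_carrier[OF z] by (metis carrier_vecD eq_vecI index_zero_vec)
    then have "j \<in> K"
      using z by (auto simp: supp_vecs_def)
    have "A *\<^sub>v x \<in> (*\<^sub>v) A ` supp_vecs n (K - {j})" if x: "x \<in> supp_vecs n K" for x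
    proof (rule image_eqI)
      \<comment> \<open>Subtracting this multiple of the kernel vector \<open>z\<close> clears
        coordinate \<open>j\<close> and keeps the image.\<close>
      let ?x = "x - (x $ j / z $ j) \<cdot>\<^sub>v z"
      have "A *\<^sub>v ?x = A *\<^sub>v x - (x $ j / z $ j) \<cdot>\<^sub>v (A *\<^sub>v z)"
        using A supp_vecs_carrier[OF x] supp_vecs_carrier[OF z]
        by (subst mult_mat_vec_minus[OF A]) (auto simp: mult_mat_vec)
      then show "A *\<^sub>v x = A *\<^sub>v ?x"
        using A Az by (auto intro!: eq_vecI)
      show "?x \<in> supp_vecs n (K - {j})"
        using x z j by (auto simp: supp_vecs_def)
    qed
    moreover have "supp_vecs n (K - {j}) \<subseteq> (supp_vecs n K :: 'a vec set)"
      by (auto simp: supp_vecs_def)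
    ultimately have "(*\<^sub>v) A ` supp_vecs n (K - {j}) = (*\<^sub>v) A ` supp_vecs n K"
      by blast
    then have "?P (K - {j})"
      using K by auto
    from min[OF this] show False
      using \<open>j \<in> K\<close> K by (metis card_Diff1_less finite_lessThan finite_subset linorder_not_less)
  qed
  then have "inj_on ((*\<^sub>v) A) (supp_vecs n K)"
    unfolding inj_on_mult_mat_vec_iff[OF A] by blast
  with K that show thesis
    by blast
qed

text \<open>A maximal independent set \<open>U\<close> of columns has as many elements as the rank.
  Listing it as the columns of \<open>C\<close> makes \<open>C\<close> a bijection from coefficient
  vectors of length \<open>card U\<close> onto the range of \<open>A\<close>. Ranks can then be
  compared by comparing exponents.\<close>

lemma card_mat_range:
  fixes A :: "'a::{field,finite} mat"
  assumes A: "A \<in> carrier_mat m n"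
  shows "card (mat_range A) = CARD('a) ^ vec_space.rank m A"
proof -
  interpret vec_space "TYPE('a)" m .
  have range_eq: "span (set (cols B)) = mat_range B" if B: "B \<in> carrier_mat m k" for B k
  proof -
    have "B *\<^sub>v x \<in> carrier_vec m" for x
      by (rule carrier_vecI) (simp add: carrier_matD(1)[OF B])
    then show ?thesis
      unfolding col_space_eq[OF B, unfolded col_space_def] mat_range_def using B by auto
  qed
  have cA: "set (cols A) \<subseteq> carrier_vec m"
    using A cols_dim by blast
  obtain U where U: "maximal U (\<lambda>T. T \<subseteq> set (cols A) \<and> lin_indpt T)" "finite U"
    using maximal_exists_superset[of "set (cols A)" "\<lambda>T. T \<subseteq> set (cols A) \<and> lin_indpt T" "{}"]
    by (auto simp: finite_lin_indpt2)
  then have sub: "U \<subseteq> set (cols A)" and li: "lin_indpt U"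
    by (auto simp: maximal_def)
  have cU: "U \<subseteq> carrier_vec m"
    using sub cA by blast
  have "set (cols A) \<subseteq> span U"
  proof
    fix s assume s: "s \<in> set (cols A)"
    show "s \<in> span U"
    proof (rule ccontr)
      assume "s \<notin> span U"
      then have "s \<notin> U"
        using span_mem[OF cU] by blast
      then have "lin_indpt (insert s U)"
        using lin_dep_iff_in_span[OF cU li, of s] \<open>s \<notin> span U\<close> s cA by auto
      with \<open>s \<notin> U\<close> show False
        using U(1) s sub unfolding maximal_def by blast
    qed
  qed
  then have span: "span U = span (set (cols A))"
    using sub cA cU by (meson span_is_monotone span_is_submodule span_is_subset subset_antisym)
  obtain us where us: "set us = U" "distinct us"
    using finite_distinct_list[OF U(2)] by blast
  define C where "C = mat_of_cols m us"
  have C: "C \<in> carrier_mat m (card U)"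
    using us by (auto simp: C_def distinct_card)
  have cols: "cols C = us"
    unfolding C_def using cU us by (simp add: cols_mat_of_cols)
  \<comment> \<open>A nonzero kernel vector of \<open>C\<close> would be a linear dependence among
    the distinct vectors \<open>us\<close>.\<close>
  have "inj_on ((*\<^sub>v) C) (supp_vecs (card U) {..<card U})"
    unfolding inj_on_mult_mat_vec_iff[OF C] using lin_depI[OF C] cols us li
    by (auto simp: supp_vecs_full)
  moreover have "mat_range A = (*\<^sub>v) C ` carrier_vec (card U)"
    using span range_eq[OF C] range_eq[OF A] C cols us by (simp add: mat_range_def)
  moreover have "card (carrier_vec (card U) :: 'a vec set) = CARD('a) ^ card U"
    using card_supp_vecs[of "{..<card U}" "card U", where 'a = 'a] by (simp add: supp_vecs_full)
  moreover have "rank A = card U"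
    by (rule rank_card_indpt[OF A U(1)])
  ultimately show ?thesis
    by (simp add: card_image supp_vecs_full)
qed

section \<open>Nonsingular blocks and the rank of a symmetric matrix\<close>

text \<open>Invertibility of the principal submatrix on \<open>K\<close>, expressed without reindexing.\<close>

definition nonsing_on :: "'a::semiring_0 mat \<Rightarrow> nat set \<Rightarrow> bool" where
  "nonsing_on A K \<longleftrightarrow>
     (\<forall>x\<in>supp_vecs (dim_col A) K. (\<forall>i\<in>K. (A *\<^sub>v x) $ i = 0) \<longrightarrow> x = 0\<^sub>v (dim_col A))"

lemma scalar_prod_supp_vecs:
  assumes "x \<in> supp_vecs n K" "y \<in> carrier_vec n" "\<And>i. i \<in> K \<Longrightarrow> y $ i = 0"
  shows "x \<bullet> y = (0::'a::semiring_0)"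
  unfolding scalar_prod_def
proof (rule sum.neutral, rule ballI)
  fix i assume "i \<in> {0..<dim_vec y}"
  then show "x $ i * y $ i = 0"
    using assms by (cases "i \<in> K") (auto simp: supp_vecs_def)
qed

lemma symmetric_mat_scalar_prod:
  fixes A :: "'a::comm_semiring_0 mat"
  assumes "A \<in> carrier_mat n n" "transpose_mat A = A" "x \<in> carrier_vec n" "y \<in> carrier_vec n"
  shows "(A *\<^sub>v x) \<bullet> y = x \<bullet> (A *\<^sub>v y)"
  using transpose_vec_mult_scalar[of A n n y x] assms by simp

lemma nonsing_on_inj_on:
  fixes A :: "'a::comm_ring mat"
  assumes "A \<in> carrier_mat n n" "nonsing_on A K" "K \<subseteq> {..<n}"
  shows "inj_on ((*\<^sub>v) A) (supp_vecs n K)"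
  unfolding inj_on_mult_mat_vec_iff[OF assms(1)]
proof (intro ballI impI)
  fix x assume x: "x \<in> supp_vecs n K" and "A *\<^sub>v x = 0\<^sub>v n"
  then have "\<forall>i\<in>K. (A *\<^sub>v x) $ i = 0"
    using assms(3) by (metis index_zero_vec(1) lessThan_iff subsetD)
  then show "x = 0\<^sub>v n"
    using x assms(2) unfolding nonsing_on_def carrier_matD(2)[OF assms(1)] by blast
qed

lemma image_supp_vecs_subset:
  "A \<in> carrier_mat m n \<Longrightarrow> (*\<^sub>v) A ` supp_vecs n K \<subseteq> mat_range A"
  by (auto simp: mat_range_def supp_vecs_def)

lemma one_less_card_field: "CARD('a::{field,finite}) > 1"
proof -
  have "card {0, 1::'a} \<le> CARD('a)"
    by (rule card_mono) auto
  then show ?thesis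
    by simp
qed

text \<open>The rows in \<open>K\<close> alone already detect every nonzero vector supported on
  \<open>K\<close>, so \<open>A\<close> is injective on these vectors and its range has at least as
  many elements.\<close>

lemma card_nonsing_on_le_rank:
  fixes A :: "'a::{field,finite} mat"
  assumes A: "A \<in> carrier_mat n n" and K: "nonsing_on A K" "K \<subseteq> {..<n}"
  shows "card K \<le> vec_space.rank n A"
proof -
  have "CARD('a) ^ card K = card ((*\<^sub>v) A ` supp_vecs n K)"
    by (simp add: card_image[OF nonsing_on_inj_on[OF A K]] card_supp_vecs[OF K(2)])
  also have "\<dots> \<le> CARD('a) ^ vec_space.rank n A"
    unfolding card_mat_range[OF A, symmetric]
    by (rule card_mono[OF finite_mat_range image_supp_vecs_subset[OF A]])
  finally show ?thesis
    by (rule power_le_imp_le_exp[OF one_less_card_field])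
qed

text \<open>At full size the injection is onto by counting. Every range vector thus has a preimage
  supported on \<open>K\<close>, which lets a solution be moved into the block.\<close>

lemma nonsing_on_image_eq_mat_range:
  fixes A :: "'a::{field,finite} mat"
  assumes A: "A \<in> carrier_mat n n" and K: "nonsing_on A K" "K \<subseteq> {..<n}"
    and "card K = vec_space.rank n A"
  shows "(*\<^sub>v) A ` supp_vecs n K = mat_range A"
  by (rule card_subset_eq[OF finite_mat_range image_supp_vecs_subset[OF A]])
    (simp add: card_image[OF nonsing_on_inj_on[OF A K]] card_supp_vecs[OF K(2)] card_mat_range[OF A]
      assms(4))

text \<open>Let \<open>K\<close> index a column basis, and let \<open>y\<close> be supported on
  \<open>K\<close> with \<open>A *\<^sub>v y\<close> zero on \<open>K\<close>. Any \<open>x\<close>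
  has the same image as some \<open>x'\<close> supported on \<open>K\<close>, so by symmetry the
  product of \<open>x\<close> with \<open>A *\<^sub>v y\<close> equals that of \<open>x'\<close>,
  which is zero. Hence \<open>A *\<^sub>v y\<close> vanishes, and \<open>y\<close> with it.\<close>

lemma symmetric_exists_nonsing_on:
  fixes A :: "'a::{field,finite} mat"
  assumes A: "A \<in> carrier_mat n n" and sym: "transpose_mat A = A"
  obtains K where "K \<subseteq> {..<n}" "nonsing_on A K" "card K = vec_space.rank n A"
proof -
  obtain K where K: "K \<subseteq> {..<n}" "inj_on ((*\<^sub>v) A) (supp_vecs n K)"
      "(*\<^sub>v) A ` supp_vecs n K = mat_range A"
    using exists_column_basis[OF A] by blast
  have "nonsing_on A K"
    unfolding nonsing_on_def
  proof (intro ballI impI)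
    fix y assume "y \<in> supp_vecs (dim_col A) K" and 0: "\<forall>i\<in>K. (A *\<^sub>v y) $ i = 0"
    then have y: "y \<in> supp_vecs n K"
      using A by simp
    have "x \<bullet> (A *\<^sub>v y) = 0" if x: "x \<in> carrier_vec n" for x
    proof -
      obtain x' where x': "x' \<in> supp_vecs n K" "A *\<^sub>v x = A *\<^sub>v x'"
        using K(3) x A by (auto simp: mat_range_def set_eq_iff image_iff)
      have "x \<bullet> (A *\<^sub>v y) = x' \<bullet> (A *\<^sub>v y)"
        using symmetric_mat_scalar_prod[OF A sym _ supp_vecs_carrier[OF y]] x x'
        by (metis supp_vecs_carrier)
      also have "\<dots> = 0"
        using scalar_prod_supp_vecs[OF x'(1) mult_mat_vec_carrier[OF A supp_vecs_carrier[OF y]]] 0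
        by blast
      finally show ?thesis .
    qed
    then have "(A *\<^sub>v y) $ i = 0" if "i < n" for i
      using scalar_prod_left_unit[OF mult_mat_vec_carrier[OF A supp_vecs_carrier[OF y]] that]
      by (metis unit_vec_carrier)
    then have "A *\<^sub>v y = 0\<^sub>v n"
      using A by (intro eq_vecI) auto
    then show "y = 0\<^sub>v (dim_col A)"
      using K(2) y A unfolding inj_on_mult_mat_vec_iff[OF A] by auto
  qed
  moreover have "card K = vec_space.rank n A"
  proof -
    have "CARD('a) ^ card K = CARD('a) ^ vec_space.rank n A"
      by (simp add: card_mat_range[OF A, symmetric] K(3)[symmetric] card_image[OF K(2)]
          card_supp_vecs[OF K(1)])
    then show ?thesis
      using one_less_card_field[where 'a = 'a] by (simp add: power_inject_exp)
  qed
  ultimately show thesis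
    using that K(1) by blast
qed

section \<open>Principal submatrices as maps on supported vectors\<close>

lemma invertible_mat_iff_det:
  fixes A :: "'a::field mat"
  assumes A: "A \<in> carrier_mat n n"
  shows "invertible_mat A \<longleftrightarrow> det A \<noteq> 0"
proof
  assume "invertible_mat A"
  then obtain B where B: "A * B = 1\<^sub>m (dim_row A)" "B * A = 1\<^sub>m (dim_row B)"
    unfolding invertible_mat_def inverts_mat_def by blast
  then have "B \<in> carrier_mat n n"
    using A by (metis carrier_matD carrier_matI index_mult_mat(2,3) index_one_mat(2,3))
  then have "det A * det B = 1"
    using B(1) A det_mult[OF A] by fastforce
  then show "det A \<noteq> 0"
    by auto
next
  assume "det A \<noteq> 0"
  then obtain B where "B \<in> carrier_mat n n" "A * B = 1\<^sub>m n" "B * A = 1\<^sub>m n"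
    using det_non_zero_imp_unit[OF A] unfolding Units_def ring_mat_def by auto
  then show "invertible_mat A"
    using A unfolding invertible_mat_def inverts_mat_def by (auto intro!: exI[of _ B])
qed

lemma principal_submatrix_carrier:
  assumes "A \<in> carrier_mat n n" "K \<subseteq> {..<n}"
  shows "principal_submatrix A K \<in> carrier_mat (card K) (card K)"
proof -
  have "{i. i < n \<and> i \<in> K} = K"
    using assms(2) by auto
  then show ?thesis
    using assms by (auto simp: principal_submatrix_def dim_submatrix)
qed

lemma principal_submatrix_index:
  assumes "A \<in> carrier_mat n n" "K \<subseteq> {..<n}" "i < card K" "j < card K"
  shows "principal_submatrix A K $$ (i, j) = A $$ (pick K i, pick K j)"
proof -
  have "{i. i < n \<and> i \<in> K} = K"
    using assms(2) by auto
  then show ?thesis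
    using assms by (auto simp: principal_submatrix_def submatrix_index)
qed

lemma bij_betw_pick:
  assumes "finite K"
  shows "bij_betw (pick K) {..<card K} K"
\<comment> \<open>The inverse sends an element of \<open>K\<close> to its position, the number of
  smaller elements.\<close>
proof (rule bij_betwI[where g = "\<lambda>i. card {a\<in>K. a < i}"])
  show "(\<lambda>i. card {a\<in>K. a < i}) \<in> K \<rightarrow> {..<card K}"
    using assms by (auto intro!: psubset_card_mono)
qed (auto simp: pick_in_set_le card_pick_le pick_card_in_set)

lemma principal_submatrix_mult_vec:
  fixes A :: "'a::semiring_0 mat"
  assumes A: "A \<in> carrier_mat n n" and K: "K \<subseteq> {..<n}" and x: "x \<in> supp_vecs n K" and i: "i < card K"
  shows "(principal_submatrix A K *\<^sub>v vec (card K) (\<lambda>j. x $ pick K j)) $ i = (A *\<^sub>v x) $ pick K i"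
proof -
  have fin: "finite K"
    using K finite_subset by blast
  have pi: "pick K i < n"
    using i K pick_in_set_le by blast
  have "(A *\<^sub>v x) $ pick K i = (\<Sum>j<n. A $$ (pick K i, j) * x $ j)"
    using A x pi by (auto simp: scalar_prod_def supp_vecs_def atLeast0LessThan)
  also have "\<dots> = (\<Sum>j\<in>K. A $$ (pick K i, j) * x $ j)"
    using K x by (intro sum.mono_neutral_right) (auto simp: supp_vecs_def)
  also have "\<dots> = (\<Sum>j<card K. A $$ (pick K i, pick K j) * x $ pick K j)"
    by (rule sum.reindex_bij_betw[OF bij_betw_pick[OF fin], symmetric])
  also have "\<dots> = (principal_submatrix A K *\<^sub>v vec (card K) (\<lambda>j. x $ pick K j)) $ i"
    using principal_submatrix_carrier[OF A K] i
    by (auto simp: scalar_prod_def atLeast0LessThan principal_submatrix_index[OF A K])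
  finally show ?thesis ..
qed

lemma invertible_principal_submatrix_iff:
  fixes A :: "'a::field mat"
  assumes A: "A \<in> carrier_mat n n" and K: "K \<subseteq> {..<n}"
  shows "invertible_mat (principal_submatrix A K) \<longleftrightarrow> nonsing_on A K"
proof -
  let ?C = "principal_submatrix A K" and ?k = "card K"
  \<comment> \<open>\<open>?r\<close> reads off the coordinates in \<open>K\<close>. On vectors
    supported on \<open>K\<close> it is bijective and carries the rows of \<open>A\<close> in
    \<open>K\<close> to the block, so the kernels correspond.\<close>
  let ?r = "\<lambda>x :: 'a vec. vec ?k (\<lambda>j. x $ pick K j)"
  have C: "?C \<in> carrier_mat ?k ?k"
    by (rule principal_submatrix_carrier[OF A K])
  have fin: "finite K"
    using K finite_subset by blast
  have im: "pick K ` {..<?k} = K"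
    using bij_betw_pick[OF fin] by (simp add: bij_betw_def)
  have zero: "?C *\<^sub>v ?r x = 0\<^sub>v ?k \<longleftrightarrow> (\<forall>i\<in>K. (A *\<^sub>v x) $ i = 0)" if "x \<in> supp_vecs n K" for x
  proof -
    have "(\<forall>i\<in>K. (A *\<^sub>v x) $ i = 0) \<longleftrightarrow> (\<forall>i<?k. (A *\<^sub>v x) $ pick K i = 0)"
      by (subst im[symmetric]) auto
    then show ?thesis
      using C principal_submatrix_mult_vec[OF A K that] by (auto simp: vec_eq_iff)
  qed
  have r0: "?r x = 0\<^sub>v ?k \<longleftrightarrow> x = 0\<^sub>v n" if "x \<in> supp_vecs n K" for x
  proof -
    have "?r x = 0\<^sub>v ?k \<longleftrightarrow> (\<forall>i\<in>K. x $ i = 0)"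
      by (subst (2) im[symmetric]) (auto simp: vec_eq_iff)
    also have "\<dots> \<longleftrightarrow> x = 0\<^sub>v n"
      using that K by (auto simp: vec_eq_iff supp_vecs_def)
    finally show ?thesis .
  qed
  have surj: "\<exists>x\<in>supp_vecs n K. ?r x = y" if y: "y \<in> carrier_vec ?k" for y
  proof (rule bexI)
    let ?x = "vec n (\<lambda>i. if i \<in> K then y $ card {a\<in>K. a < i} else 0)"
    show "?x \<in> supp_vecs n K"
      by (auto simp: supp_vecs_def)
    have "pick K j \<in> K" "pick K j < n" if "j < ?k" for j
      using that K pick_in_set_le by blast+
    then show "?r ?x = y"
      using y by (auto simp: vec_eq_iff card_pick_le)
  qed
  have "det ?C \<noteq> 0 \<longleftrightarrow> (\<forall>y\<in>carrier_vec ?k. ?C *\<^sub>v y = 0\<^sub>v ?k \<longrightarrow> y = 0\<^sub>v ?k)"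
    using det_0_iff_vec_prod_zero_field[OF C] by blast
  also have "\<dots> \<longleftrightarrow> (\<forall>x\<in>supp_vecs n K. ?C *\<^sub>v ?r x = 0\<^sub>v ?k \<longrightarrow> ?r x = 0\<^sub>v ?k)"
    using surj by (metis vec_carrier)
  also have "\<dots> \<longleftrightarrow> nonsing_on A K"
    using zero r0 A by (auto simp: nonsing_on_def)
  finally show ?thesis
    by (simp add: invertible_mat_iff_det[OF C])
qed

text \<open>For symmetric matrices the maximality condition in the definition of \<open>psd1\<close> says that the
  chosen principal submatrix has the full rank.\<close>

lemma maximal_invertible_iff_rank:
  fixes A :: "'a::{field,finite} mat"
  assumes A: "A \<in> carrier_mat n n" and sym: "transpose_mat A = A"
    and K: "K \<subseteq> {..<n}" "invertible_mat (principal_submatrix A K)"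
  shows "(\<forall>M\<subseteq>{..<n}. card M > card K \<longrightarrow> \<not> invertible_mat (principal_submatrix A M)) \<longleftrightarrow>
    card K = vec_space.rank n A"
proof
  assume max: "\<forall>M\<subseteq>{..<n}. card M > card K \<longrightarrow> \<not> invertible_mat (principal_submatrix A M)"
  obtain M where M: "M \<subseteq> {..<n}" "nonsing_on A M" "card M = vec_space.rank n A"
    using symmetric_exists_nonsing_on[OF A sym] by blast
  then have "card K \<ge> vec_space.rank n A"
    using max invertible_principal_submatrix_iff[OF A] by (metis not_le)
  moreover have "card K \<le> vec_space.rank n A"
    using card_nonsing_on_le_rank[OF A] K invertible_principal_submatrix_iff[OF A] by blast
  ultimately show "card K = vec_space.rank n A"
    by simp
next
  assume "card K = vec_space.rank n A"
  then show "\<forall>M\<subseteq>{..<n}. card M > card K \<longrightarrow> \<not> invertible_mat (principal_submatrix A M)"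
    using card_nonsing_on_le_rank[OF A] invertible_principal_submatrix_iff[OF A]
    by (metis not_le)
qed

section \<open>Bordered matrices and their principal submatrices\<close>

definition border :: "'a mat \<Rightarrow> 'a vec \<Rightarrow> 'a \<Rightarrow> 'a mat" where
  "border B v a = mat (Suc (dim_row B)) (Suc (dim_row B))
     (\<lambda>(i, j). if i < dim_row B then if j < dim_row B then B $$ (i, j) else v $ i
               else if j < dim_row B then v $ j else a)"

definition snoc_vec :: "'a vec \<Rightarrow> 'a \<Rightarrow> 'a vec" where
  "snoc_vec x c = vec (Suc (dim_vec x)) (\<lambda>i. if i < dim_vec x then x $ i else c)"

lemma border_carrier: "B \<in> carrier_mat n n \<Longrightarrow> border B v a \<in> carrier_mat (Suc n) (Suc n)"
  by (simp add: border_def)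

lemma border_index:
  assumes "B \<in> carrier_mat n n" "i < Suc n" "j < Suc n"
  shows "border B v a $$ (i, j) =
    (if i < n then if j < n then B $$ (i, j) else v $ i else if j < n then v $ j else a)"
  using assms by (simp add: border_def)

lemma snoc_vec_carrier: "x \<in> carrier_vec n \<Longrightarrow> snoc_vec x c \<in> carrier_vec (Suc n)"
  by (simp add: snoc_vec_def)

lemma snoc_vec_eq_iff:
  assumes "x \<in> carrier_vec n" "y \<in> carrier_vec n"
  shows "snoc_vec x c = snoc_vec y d \<longleftrightarrow> x = y \<and> c = d"
proof
  assume eq: "snoc_vec x c = snoc_vec y d"
  have "x $ i = y $ i" if "i < n" for i
    using arg_cong[OF eq, of "\<lambda>z. z $ i"] assms that by (simp add: snoc_vec_def)
  moreover have "c = d"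
    using arg_cong[OF eq, of "\<lambda>z. z $ n"] assms by (simp add: snoc_vec_def)
  ultimately show "x = y \<and> c = d"
    using assms by (auto intro: eq_vecI)
qed simp

lemma snoc_vec_cases:
  assumes "z \<in> carrier_vec (Suc n)"
  obtains x c where "x \<in> carrier_vec n" "z = snoc_vec x c"
proof
  show "vec n (($) z) \<in> carrier_vec n"
    by simp
  show "z = snoc_vec (vec n (($) z)) (z $ n)"
    using assms by (intro eq_vecI) (auto simp: snoc_vec_def less_Suc_eq)
qed

lemma border_mult_snoc_vec:
  fixes B :: "'a::comm_semiring_0 mat"
  assumes "B \<in> carrier_mat n n" "v \<in> carrier_vec n" "x \<in> carrier_vec n"
  shows "border B v a *\<^sub>v snoc_vec x c = snoc_vec (B *\<^sub>v x + c \<cdot>\<^sub>v v) (v \<bullet> x + a * c)"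
  using assms
  by (intro eq_vecI)
    (auto simp: border_def snoc_vec_def scalar_prod_def atLeast0LessThan lessThan_Suc mult.commute
      add.commute less_Suc_eq)

lemma border_eq_iff:
  assumes "B \<in> carrier_mat n n" "v \<in> carrier_vec n" "B' \<in> carrier_mat n n" "v' \<in> carrier_vec n"
  shows "border B v a = border B' v' a' \<longleftrightarrow> B = B' \<and> v = v' \<and> a = a'"
proof
  assume eq: "border B v a = border B' v' a'"
  have entry: "border B v a $$ (i, j) = border B' v' a' $$ (i, j)" for i j
    by (simp only: eq)
  have "B $$ (i, j) = B' $$ (i, j)" if "i < n" "j < n" for i j
    using entry[of i j] assms that by (simp add: border_def)
  moreover have "v $ i = v' $ i" if "i < n" for i
    using entry[of i n] assms that by (simp add: border_def)
  moreover have "a = a'"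
    using entry[of n n] assms by (simp add: border_def)
  ultimately show "B = B' \<and> v = v' \<and> a = a'"
    using assms by (auto intro: eq_vecI eq_matI)
qed simp

lemma transpose_border_iff:
  assumes B: "B \<in> carrier_mat n n"
  shows "transpose_mat (border B v a) = border B v a \<longleftrightarrow> transpose_mat B = B"
proof
  assume eq: "transpose_mat (border B v a) = border B v a"
  have "B $$ (j, i) = B $$ (i, j)" if "i < n" "j < n" for i j
  proof -
    have "border B v a $$ (j, i) = transpose_mat (border B v a) $$ (i, j)"
      using that border_carrier[OF B, of v a] by simp
    then show ?thesis
      unfolding eq using that by (simp add: border_index[OF B])
  qed
  then show "transpose_mat B = B"
    using B by (auto intro!: eq_matI)
next
  assume eq: "transpose_mat B = B"
  have "B $$ (j, i) = B $$ (i, j)" if "i < n" "j < n" for i j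
    using B that by (subst (2) eq[symmetric]) simp
  then show "transpose_mat (border B v a) = border B v a"
    using B by (auto intro!: eq_matI simp: border_def)
qed

lemma symmetric_border_cases:
  assumes A: "A \<in> carrier_mat (Suc n) (Suc n)" and sym: "transpose_mat A = A"
  obtains B v a where "B \<in> carrier_mat n n" "v \<in> carrier_vec n" "A = border B v a"
proof
  show "mat n n (($$) A) \<in> carrier_mat n n" "vec n (\<lambda>i. A $$ (i, n)) \<in> carrier_vec n"
    by simp_all
  have "A $$ (j, n) = A $$ (n, j)" if "j < n" for j
    using A that by (subst sym[symmetric]) simp
  then show "A = border (mat n n (($$) A)) (vec n (\<lambda>i. A $$ (i, n))) (A $$ (n, n))"
    using A by (intro eq_matI) (auto simp: border_def less_Suc_eq)
qed

lemma principal_submatrix_border: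
  assumes "B \<in> carrier_mat n n" "K \<subseteq> {..<n}"
  shows "principal_submatrix (border B v a) K = principal_submatrix B K"
proof (rule eq_matI)
  have K: "K \<subseteq> {..<Suc n}"
    using assms(2) by auto
  note C = principal_submatrix_carrier[OF assms]
    and D = principal_submatrix_carrier[OF border_carrier[OF assms(1)] K, of v a]
  show "dim_row (principal_submatrix (border B v a) K) = dim_row (principal_submatrix B K)"
    "dim_col (principal_submatrix (border B v a) K) = dim_col (principal_submatrix B K)"
    using C D by auto
  fix i j assume "i < dim_row (principal_submatrix B K)" "j < dim_col (principal_submatrix B K)"
  then have ij: "i < card K" "j < card K"
    using C by auto
  then have "pick K i < n" "pick K j < n"
    using assms(2) pick_in_set_le by blast+
  then show "principal_submatrix (border B v a) K $$ (i, j) = principal_submatrix B K $$ (i, j)"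
    using ij
    by (simp add: principal_submatrix_index[OF assms] border_index[OF assms(1)]
        principal_submatrix_index[OF border_carrier[OF assms(1)] K])
qed

text \<open>The new index exceeds all of \<open>K\<close>, so it is enumerated last. This is why a
  block that uses the new index is again a bordered matrix.\<close>

lemma pick_insert_greater:
  assumes "K \<subseteq> {..<n}" "i \<le> card K"
  shows "pick (insert n K) i = (if i < card K then pick K i else n)"
proof (cases "i < card K")
  case True
  then have p: "pick K i \<in> K" "pick K i < n"
    using assms(1) pick_in_set_le by blast+
  then have "{a \<in> insert n K. a < pick K i} = {a \<in> K. a < pick K i}"
    by auto
  then show ?thesis
    using True p pick_card_in_set[of "pick K i" "insert n K"] by (simp add: card_pick_le)
next
  case False
  have "{a \<in> insert n K. a < n} = K"
    using assms(1) by auto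
  then show ?thesis
    using False assms(2) pick_card_in_set[of n "insert n K"] by simp
qed

lemma principal_submatrix_border_insert:
  assumes "B \<in> carrier_mat n n" "K \<subseteq> {..<n}"
  shows "principal_submatrix (border B v a) (insert n K) =
    border (principal_submatrix B K) (vec (card K) (\<lambda>i. v $ pick K i)) a"
proof (rule eq_matI)
  let ?D = "principal_submatrix (border B v a) (insert n K)"
  let ?E = "border (principal_submatrix B K) (vec (card K) (\<lambda>i. v $ pick K i)) a"
  have K: "insert n K \<subseteq> {..<Suc n}"
    using assms(2) by auto
  have cK: "card (insert n K) = Suc (card K)"
    using assms(2) by (subst card_insert_disjoint) (auto intro: finite_subset)
  note C = principal_submatrix_carrier[OF assms]
  note D = principal_submatrix_carrier[OF border_carrier[OF assms(1)] K, of v a]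
  note E = border_carrier[OF C, of "vec (card K) (\<lambda>i. v $ pick K i)" a]
  show "dim_row ?D = dim_row ?E" "dim_col ?D = dim_col ?E"
    using D E cK by auto
  fix i j assume "i < dim_row ?E" "j < dim_col ?E"
  then have ij: "i < card (insert n K)" "j < card (insert n K)"
    using E cK by auto
  have "pick K l < n" if "l < card K" for l
    using that assms(2) pick_in_set_le by blast
  then show "?D $$ (i, j) = ?E $$ (i, j)"
    using ij
    by (subst principal_submatrix_index[OF border_carrier[OF assms(1)] K ij])
      (auto simp: pick_insert_greater[OF assms(2)] cK border_index[OF assms(1)] border_index[OF C]
        principal_submatrix_index[OF assms] less_Suc_eq)
qed

lemma principal_submatrix_full:
  assumes "A \<in> carrier_mat n n"
  shows "principal_submatrix A {..<n} = A"
proof -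
  have "pick {..<n} i = i" if "i < n" for i
  proof -
    have "{a \<in> {..<n}. a < i} = {..<i}"
      using that by auto
    then show ?thesis
      using pick_card_in_set[of i "{..<n}"] that by simp
  qed
  then show ?thesis
    using principal_submatrix_carrier[OF assms order_refl] assms
    by (intro eq_matI) (auto simp: principal_submatrix_index[OF assms order_refl])
qed

section \<open>\<open>pd1\<close> and \<open>psd1\<close> under bordering\<close>

lemma pd1_iff:
  assumes C: "C \<in> carrier_mat k k"
  shows "pd1 C \<longleftrightarrow> transpose_mat C = C \<and>
    (\<forall>j\<in>{1..k}. positive_elem (det (principal_submatrix C {..<j})))"
proof -
  have "det C \<noteq> 0" if pos: "\<forall>j\<in>{1..k}. positive_elem (det (principal_submatrix C {..<j}))"
  proof (cases "k = 0")
    case True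
    then show ?thesis
      using C by (simp add: det_dim_zero)
  next
    case False
    then have "positive_elem (det (principal_submatrix C {..<k}))"
      using pos by simp
    then show ?thesis
      by (auto simp: principal_submatrix_full[OF C] positive_elem_def)
  qed
  then show ?thesis
    using C by (auto simp: pd1_def invertible_mat_iff_det[OF C])
qed

text \<open>All leading principal minors except the full determinant lie inside \<open>C\<close>.
  From right to left this enlarges a PD_1 block, from left to right it drops the last index.\<close>

lemma pd1_border_iff:
  assumes C: "C \<in> carrier_mat k k"
  shows "pd1 (border C w a) \<longleftrightarrow> pd1 C \<and> positive_elem (det (border C w a))"
proof -
  have "{1..Suc k} = insert (Suc k) {1..k}"
    by auto
  moreover have "principal_submatrix (border C w a) {..<j} = principal_submatrix C {..<j}"
    if "j \<in> {1..k}" for j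
    using that by (intro principal_submatrix_border[OF C]) auto
  ultimately show ?thesis
    by (auto simp: pd1_iff[OF C] pd1_iff[OF border_carrier[OF C]] transpose_border_iff[OF C]
        principal_submatrix_full[OF border_carrier[OF C]])
qed

lemma invertible_mat_pd1: "pd1 C \<Longrightarrow> invertible_mat C"
  by (simp add: pd1_def)

text \<open>The clauses for \<open>m\<close> up to \<open>n\<close> see only blocks inside
  \<open>B\<close>. The one new clause, for \<open>m = Suc n\<close>, is put in its rank
  form.\<close>

lemma psd1_border_iff:
  fixes B :: "'a::{field,finite} mat"
  assumes B: "B \<in> carrier_mat n n"
  shows "psd1 (border B v a) \<longleftrightarrow> psd1 B \<and>
    (\<exists>K\<subseteq>{..<Suc n}. pd1 (principal_submatrix (border B v a) K) \<and>
       card K = vec_space.rank (Suc n) (border B v a))"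
proof -
  let ?A = "border B v a"
  let ?P = "\<lambda>C m. \<exists>K\<subseteq>{..<m}. pd1 (principal_submatrix C K) \<and>
        (\<forall>M\<subseteq>{..<m}. card M > card K \<longrightarrow> \<not> invertible_mat (principal_submatrix C M))"
  note A = border_carrier[OF B, of v a]
  have "{1..Suc n} = insert (Suc n) {1..n}"
    by auto
  moreover have "?P ?A m \<longleftrightarrow> ?P B m" if "m \<in> {1..n}" for m
  proof -
    have "principal_submatrix ?A K = principal_submatrix B K" if "K \<subseteq> {..<m}" for K
      using that \<open>m \<in> {1..n}\<close> by (intro principal_submatrix_border[OF B]) auto
    then show ?thesis
      by (metis (no_types, lifting))
  qed
  moreover have "?P ?A (Suc n) \<longleftrightarrow> (\<exists>K\<subseteq>{..<Suc n}. pd1 (principal_submatrix ?A K) \<and>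
       card K = vec_space.rank (Suc n) ?A)" if "transpose_mat ?A = ?A"
    using maximal_invertible_iff_rank[OF A that] invertible_mat_pd1 by blast
  ultimately show ?thesis
    using A B transpose_border_iff[OF B, of v a] by (auto simp: psd1_def)
qed

lemma psd1_obtain_full_rank:
  fixes B :: "'a::{field,finite} mat"
  assumes B: "B \<in> carrier_mat n n" and psd: "psd1 B"
  obtains K where "K \<subseteq> {..<n}" "pd1 (principal_submatrix B K)" "card K = vec_space.rank n B"
proof -
  have sym: "transpose_mat B = B"
    using psd by (simp add: psd1_def)
  obtain K where K: "K \<subseteq> {..<n}" "pd1 (principal_submatrix B K)"
    "\<forall>M\<subseteq>{..<n}. card M > card K \<longrightarrow> \<not> invertible_mat (principal_submatrix B M)"
  proof (cases "n = 0")
    \<comment> \<open>For \<open>n = 0\<close> there is no \<open>m\<close> to instantiate in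
      \<open>psd1\<close>; the empty block has the full rank.\<close>
    case True
    have "principal_submatrix B {} \<in> carrier_mat 0 0"
      using principal_submatrix_carrier[OF B, of "{}"] by simp
    then have "pd1 (principal_submatrix B {})"
      by (auto simp: pd1_iff)
    with True show thesis
      using that[of "{}"] by auto
  next
    case False
    then have "n \<in> {1..dim_row B}"
      using B by auto
    then show thesis
      using psd that unfolding psd1_def by blast
  qed
  then have "card K = vec_space.rank n B"
    using maximal_invertible_iff_rank[OF B sym K(1)] invertible_mat_pd1 by blast
  with K that show thesis
    by blast
qed

section \<open>Determinant and rank when bordering by a vector of the range\<close>

text \<open>A Schur complement computed without inverting \<open>C\<close>: multiplying by the
  unipotent \<open>E\<close> subtracts from the last column the combination \<open>w\<close> of the
  others, which clears it above the corner.\<close>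

lemma det_border:
  fixes C :: "'a::idom mat"
  assumes C: "C \<in> carrier_mat k k" and w: "w \<in> carrier_vec k"
  shows "det (border C (C *\<^sub>v w) a) = det C * (a - w \<bullet> (C *\<^sub>v w))"
proof -
  define v where "v = C *\<^sub>v w"
  have v: "v \<in> carrier_vec k"
    using C w by (simp add: v_def)
  define R where "R = mat 1 k (\<lambda>(_, j). v $ j)"
  define E where "E = four_block_mat (1\<^sub>m k) (mat k 1 (\<lambda>(i, _). - w $ i)) (0\<^sub>m 1 k) (1\<^sub>m 1)"
  have entry: "(\<Sum>j<k. C $$ (i, j) * w $ j) = v $ i" if "i < k" for i
    using C w that by (simp add: v_def scalar_prod_def atLeast0LessThan)
  have "border C v a * E = four_block_mat C (0\<^sub>m k 1) R (mat 1 1 (\<lambda>_. a - w \<bullet> v))"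
    (is "_ = ?L")
  proof -
    have "border C v a = four_block_mat C (mat k 1 (\<lambda>(i, _). v $ i)) R (mat 1 1 (\<lambda>_. a))"
      using C by (intro eq_matI) (auto simp: border_def R_def)
    also have "\<dots> * E = four_block_mat
        (C * 1\<^sub>m k + mat k 1 (\<lambda>(i, _). v $ i) * 0\<^sub>m 1 k)
        (C * mat k 1 (\<lambda>(i, _). - w $ i) + mat k 1 (\<lambda>(i, _). v $ i) * 1\<^sub>m 1)
        (R * 1\<^sub>m k + mat 1 1 (\<lambda>_. a) * 0\<^sub>m 1 k)
        (R * mat k 1 (\<lambda>(i, _). - w $ i) + mat 1 1 (\<lambda>_. a) * 1\<^sub>m 1)"
      unfolding E_def by (rule mult_four_block_mat) (use C in \<open>auto simp: R_def\<close>)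
    also have "C * 1\<^sub>m k + mat k 1 (\<lambda>(i, _). v $ i) * 0\<^sub>m 1 k = C"
      using C by (simp add: right_add_zero_mat[where nr = k and nc = k])
    also have "C * mat k 1 (\<lambda>(i, _). - w $ i) + mat k 1 (\<lambda>(i, _). v $ i) * 1\<^sub>m 1 = 0\<^sub>m k 1"
      using C entry by (intro eq_matI) (auto simp: scalar_prod_def atLeast0LessThan sum_negf)
    also have "R * 1\<^sub>m k + mat 1 1 (\<lambda>_. a) * 0\<^sub>m 1 k = R"
      by (intro eq_matI) (auto simp: R_def)
    also have "R * mat k 1 (\<lambda>(i, _). - w $ i) + mat 1 1 (\<lambda>_. a) * 1\<^sub>m 1 = mat 1 1 (\<lambda>_. a - w \<bullet> v)"
      using v by (intro eq_matI)
        (auto simp: R_def scalar_prod_def atLeast0LessThan sum_negf mult.commute)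
    finally show ?thesis .
  qed
  moreover have E: "E \<in> carrier_mat (Suc k) (Suc k)"
  proof -
    have "E \<in> carrier_mat (k + 1) (k + 1)"
      unfolding E_def by (rule four_block_carrier_mat) auto
    then show ?thesis
      by simp
  qed
  ultimately have "det (border C v a) * det E = det ?L"
    by (metis det_mult[OF border_carrier[OF C] E])
  moreover have "det E = 1"
    unfolding E_def by (subst det_four_block_mat_lower_left_zero[of _ k _ 1]) auto
  moreover have "det ?L = det C * (a - w \<bullet> v)"
    by (subst det_four_block_mat_upper_right_zero[OF C refl, of _ 1]) (auto simp: R_def det_single)
  ultimately show ?thesis
    by (simp add: v_def)
qed

lemma card_mat_range_border:
  fixes B :: "'a::{field,finite} mat"
  assumes B: "B \<in> carrier_mat n n" and sym: "transpose_mat B = B" and w: "w \<in> carrier_vec n"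
  shows "card (mat_range (border B (B *\<^sub>v w) a)) =
    card (mat_range B) * (if a = w \<bullet> (B *\<^sub>v w) then 1 else CARD('a))"
proof -
  let ?v = "B *\<^sub>v w" and ?A = "border B (B *\<^sub>v w) a"
  define d where "d = a - w \<bullet> ?v"
  \<comment> \<open>The set of multiples of \<open>d\<close>; over a field it is zero or
    everything.\<close>
  define \<Gamma> where "\<Gamma> = (if d = 0 then {0} else (UNIV :: 'a set))"
  \<comment> \<open>The bordered matrix is the product of a shear, diag(\<open>B\<close>,
    \<open>d\<close>) and the transposed shear. \<open>\<phi>\<close> is the left factor; the right
    one sends (x, c) to (x + c w, c). Both are bijective, so the range has the size of that of
    diag(\<open>B\<close>, \<open>d\<close>).\<close>
  define \<phi> where "\<phi> = (\<lambda>(b, c). snoc_vec b (w \<bullet> b + c))"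
  have v: "?v \<in> carrier_vec n"
    using B w by simp
  have d: "d * c \<in> \<Gamma>" for c
    by (simp add: \<Gamma>_def)
  have mult: "?A *\<^sub>v snoc_vec x c = \<phi> (B *\<^sub>v (x + c \<cdot>\<^sub>v w), d * c)" if x: "x \<in> carrier_vec n" for x c
  proof -
    have "?v \<bullet> x = w \<bullet> (B *\<^sub>v x)"
      by (rule symmetric_mat_scalar_prod[OF B sym w x])
    moreover have "B *\<^sub>v (x + c \<cdot>\<^sub>v w) = B *\<^sub>v x + c \<cdot>\<^sub>v ?v"
      using B x w by (simp add: mult_add_distrib_mat_vec[of _ n n] mult_mat_vec[OF B])
    moreover have "w \<bullet> (B *\<^sub>v x + c \<cdot>\<^sub>v ?v) = w \<bullet> (B *\<^sub>v x) + c * (w \<bullet> ?v)"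
      using B x w v by (simp add: scalar_prod_add_distrib[of _ n])
    ultimately show ?thesis
      by (simp add: border_mult_snoc_vec[OF B v x] \<phi>_def d_def algebra_simps)
  qed
  have "mat_range ?A = \<phi> ` (mat_range B \<times> \<Gamma>)"
  proof (intro equalityI subsetI)
    fix y assume "y \<in> mat_range ?A"
    then obtain z where "z \<in> carrier_vec (Suc n)" "y = ?A *\<^sub>v z"
      using border_carrier[OF B, of ?v a] by (auto simp: mat_range_def)
    then obtain x c where "x \<in> carrier_vec n" "y = ?A *\<^sub>v snoc_vec x c"
      by (metis snoc_vec_cases)
    then have "y = \<phi> (B *\<^sub>v (x + c \<cdot>\<^sub>v w), d * c)" "x + c \<cdot>\<^sub>v w \<in> carrier_vec n"
      using mult w by auto
    then show "y \<in> \<phi> ` (mat_range B \<times> \<Gamma>)"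
      using B d by (auto simp: mat_range_def)
  next
    fix y assume "y \<in> \<phi> ` (mat_range B \<times> \<Gamma>)"
    then obtain x c' where x: "x \<in> carrier_vec n" and y: "y = \<phi> (B *\<^sub>v x, c')" and "c' \<in> \<Gamma>"
      using B by (auto simp: mat_range_def)
    then obtain c where c: "c' = d * c"
      by (metis \<Gamma>_def mult.commute mult_zero_left nonzero_eq_divide_eq singletonD)
    have "x - c \<cdot>\<^sub>v w + c \<cdot>\<^sub>v w = x"
      using x w by (intro eq_vecI) auto
    then have "y = ?A *\<^sub>v snoc_vec (x - c \<cdot>\<^sub>v w) c"
      using x w by (subst mult) (auto simp: y c)
    moreover have "snoc_vec (x - c \<cdot>\<^sub>v w) c \<in> carrier_vec (Suc n)"
      using x w by (intro snoc_vec_carrier) auto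
    ultimately show "y \<in> mat_range ?A"
      using border_carrier[OF B, of ?v a] by (auto simp: mat_range_def)
  qed
  moreover have "inj_on \<phi> (mat_range B \<times> \<Gamma>)"
    using B by (auto simp: inj_on_def \<phi>_def mat_range_def snoc_vec_eq_iff[of _ n])
  ultimately have "card (mat_range ?A) = card (mat_range B) * card \<Gamma>"
    by (simp add: card_image card_cartesian_product)
  then show ?thesis
    by (auto simp: \<Gamma>_def d_def)
qed

lemma rank_border:
  fixes B :: "'a::{field,finite} mat"
  assumes B: "B \<in> carrier_mat n n" and sym: "transpose_mat B = B" and w: "w \<in> carrier_vec n"
  shows "vec_space.rank (Suc n) (border B (B *\<^sub>v w) a) =
    vec_space.rank n B + (if a = w \<bullet> (B *\<^sub>v w) then 0 else 1)"
proof -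
  have "CARD('a) ^ vec_space.rank (Suc n) (border B (B *\<^sub>v w) a) =
    CARD('a) ^ (vec_space.rank n B + (if a = w \<bullet> (B *\<^sub>v w) then 0 else 1))"
    using card_mat_range_border[OF assms, of a] card_mat_range[OF B]
      card_mat_range[OF border_carrier[OF B, of "B *\<^sub>v w" a]]
    by (simp split: if_splits)
  then show ?thesis
    using one_less_card_field[where 'a = 'a] by (metis power_inject_exp)
qed

text \<open>The block only knows vectors supported on \<open>K\<close>, so \<open>w\<close> is
  replaced by such a \<open>u\<close> with the same image. By symmetry \<open>u\<close> and
  \<open>w\<close> have the same product with \<open>B *\<^sub>v w\<close>, so the Schur complement
  over the block is that over \<open>B\<close>, whatever the choice of \<open>K\<close>.\<close>

lemma det_principal_submatrix_border_insert:
  fixes B :: "'a::{field,finite} mat"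
  assumes B: "B \<in> carrier_mat n n" and sym: "transpose_mat B = B" and w: "w \<in> carrier_vec n"
    and K: "K \<subseteq> {..<n}" "nonsing_on B K" "card K = vec_space.rank n B"
  shows "det (principal_submatrix (border B (B *\<^sub>v w) a) (insert n K)) =
    det (principal_submatrix B K) * (a - w \<bullet> (B *\<^sub>v w))"
proof -
  let ?C = "principal_submatrix B K"
  let ?r = "\<lambda>x :: 'a vec. vec (card K) (\<lambda>i. x $ pick K i)"
  note C = principal_submatrix_carrier[OF B K(1)]
  have fin: "finite K"
    using K(1) finite_subset by blast
  have "B *\<^sub>v w \<in> (*\<^sub>v) B ` supp_vecs n K"
    using nonsing_on_image_eq_mat_range[OF B K(2,1,3)] w B by (auto simp: mat_range_def)
  then obtain u where u: "u \<in> supp_vecs n K" "B *\<^sub>v u = B *\<^sub>v w"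
    by (metis imageE)
  then have u': "u \<in> carrier_vec n"
    by (simp add: supp_vecs_carrier)
  have Cu: "?C *\<^sub>v ?r u = ?r (B *\<^sub>v w)"
    using principal_submatrix_mult_vec[OF B K(1) u(1)] C u(2) by (intro eq_vecI) auto
  have "?r u \<bullet> ?r (B *\<^sub>v w) = (\<Sum>i<card K. u $ pick K i * (B *\<^sub>v w) $ pick K i)"
    by (simp add: scalar_prod_def atLeast0LessThan)
  also have "\<dots> = (\<Sum>i\<in>K. u $ i * (B *\<^sub>v w) $ i)"
    by (rule sum.reindex_bij_betw[OF bij_betw_pick[OF fin]])
  also have "\<dots> = (\<Sum>i<n. u $ i * (B *\<^sub>v w) $ i)"
    using K(1) u(1) by (intro sum.mono_neutral_left) (auto simp: supp_vecs_def)
  also have "\<dots> = u \<bullet> (B *\<^sub>v w)"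
    using B by (simp add: scalar_prod_def atLeast0LessThan)
  also have "\<dots> = w \<bullet> (B *\<^sub>v w)"
    using symmetric_mat_scalar_prod[OF B sym u' w] symmetric_mat_scalar_prod[OF B sym w w] u(2)
    by simp
  finally show ?thesis
    using det_border[OF C, of "?r u" a]
    by (simp add: principal_submatrix_border_insert[OF B K(1)] Cu)
qed

section \<open>Positive elements and removal of the last index\<close>

lemma positive_elem_nonzero: "positive_elem a \<Longrightarrow> a \<noteq> 0"
  by (auto simp: positive_elem_def)

lemma positive_elem_mult_iff:
  assumes "positive_elem c"
  shows "positive_elem (c * d) \<longleftrightarrow> positive_elem d"
proof
  obtain b where b: "b \<noteq> 0" "c = b ^ 2"
    using assms by (auto simp: positive_elem_def)
  {
    assume "positive_elem (c * d)"
    then obtain e where "e \<noteq> 0" "c * d = e ^ 2"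
      by (auto simp: positive_elem_def)
    then have "e / b \<noteq> 0" "d = (e / b) ^ 2"
      using b by (auto simp: power_divide field_simps)
    then show "positive_elem d"
      unfolding positive_elem_def by blast
  next
    assume "positive_elem d"
    then obtain e where "e \<noteq> 0" "d = e ^ 2"
      by (auto simp: positive_elem_def)
    then have "b * e \<noteq> 0" "c * d = (b * e) ^ 2"
      using b by (auto simp: power_mult_distrib)
    then show "positive_elem (c * d)"
      unfolding positive_elem_def by blast
  }
qed

lemma pd1_positive_det:
  assumes C: "C \<in> carrier_mat k k" and "pd1 C"
  shows "positive_elem (det C)"
proof (cases "k = 0")
  case True
  then show ?thesis
    using C by (auto simp: positive_elem_def det_dim_zero intro: exI[of _ 1])
next
  case False
  then show ?thesis
    using assms(2) unfolding pd1_iff[OF C]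
    by (metis One_nat_def Suc_leI atLeastAtMost_iff le_refl neq0_conv principal_submatrix_full[OF C])
qed

lemma card_pd1_le_rank:
  fixes A :: "'a::{field,finite} mat"
  assumes "A \<in> carrier_mat n n" "K \<subseteq> {..<n}" "pd1 (principal_submatrix A K)"
  shows "card K \<le> vec_space.rank n A"
  using assms card_nonsing_on_le_rank invertible_principal_submatrix_iff invertible_mat_pd1 by blast

text \<open>The index \<open>n\<close>, if present, is the largest in \<open>K\<close>, so what
  remains is a leading principal block of a PD_1 matrix.\<close>

lemma pd1_border_remove:
  fixes B :: "'a::field mat"
  assumes B: "B \<in> carrier_mat n n" and K: "K \<subseteq> {..<Suc n}" "pd1 (principal_submatrix (border B v a) K)"
  shows "pd1 (principal_submatrix B (K - {n}))"
proof (cases "n \<in> K")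
  case True
  define K' where "K' = K - {n}"
  have K': "K = insert n K'" "K' \<subseteq> {..<n}"
    using True K(1) by (auto simp: K'_def less_Suc_eq)
  have "pd1 (principal_submatrix (border B v a) (insert n K'))"
    using K(2) K'(1) by simp
  then show ?thesis
    by (simp add: principal_submatrix_border_insert[OF B K'(2)] K'_def[symmetric]
        pd1_border_iff[OF principal_submatrix_carrier[OF B K'(2)]])
next
  case False
  then have "K \<subseteq> {..<n}"
    using K(1) less_Suc_eq by auto
  then show ?thesis
    using False K(2) by (simp add: principal_submatrix_border[OF B])
qed

section \<open>Bordering by a vector outside the range\<close>

text \<open>If \<open>v\<close> is outside the range of \<open>B\<close>, the rank jumps by two: on top of the support \<open>K\<close> of
  a nonsingular block of full rank in \<open>B\<close>, the new index and any index \<open>j\<close> at which \<open>v\<close> differs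
  from the range vector agreeing with it on \<open>K\<close> give a nonsingular block of \<open>border B v a\<close>.\<close>

lemma rank_border_not_in_range:
  fixes B :: "'a::{field,finite} mat"
  assumes B: "B \<in> carrier_mat n n" and sym: "transpose_mat B = B"
    and v: "v \<in> carrier_vec n" "v \<notin> mat_range B"
  shows "vec_space.rank (Suc n) (border B v a) \<ge> vec_space.rank n B + 2"
proof -
  obtain K where K: "K \<subseteq> {..<n}" "nonsing_on B K" "card K = vec_space.rank n B"
    using symmetric_exists_nonsing_on[OF B sym] by blast
  have range: "(*\<^sub>v) B ` supp_vecs n K = mat_range B"
    by (rule nonsing_on_image_eq_mat_range[OF B K(2,1,3)])
  have ker: "x = 0\<^sub>v n" if "x \<in> supp_vecs n K" "\<And>i. i \<in> K \<Longrightarrow> (B *\<^sub>v x) $ i = 0" for x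
    using K(2) that B by (auto simp: nonsing_on_def)
  obtain w where w: "w \<in> supp_vecs n K" "\<And>i. i \<in> K \<Longrightarrow> (B *\<^sub>v w) $ i = v $ i"
  proof -
    let ?mask = "\<lambda>y. vec n (\<lambda>i. if i \<in> K then y $ i else 0)"
    \<comment> \<open>Applying \<open>B\<close> and then erasing the coordinates outside
      \<open>K\<close> maps the finite set of vectors supported on \<open>K\<close> to itself.
      Nonsingularity makes this injective, hence onto, and \<open>w\<close> is a preimage of
      \<open>v\<close> with those coordinates erased.\<close>
    let ?h = "\<lambda>x. ?mask (B *\<^sub>v x)"
    have mask_eq: "y $ i = z $ i" if "?mask y = ?mask z" "i \<in> K" for y z and i
      using arg_cong[OF that(1), of "\<lambda>u. u $ i"] that(2) K(1) by auto
    have "inj_on ?h (supp_vecs n K)"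
    proof (rule inj_onI)
      fix x y assume xy: "x \<in> supp_vecs n K" "y \<in> supp_vecs n K" "?h x = ?h y"
      have c: "x \<in> carrier_vec n" "y \<in> carrier_vec n"
        using xy by (auto simp: supp_vecs_carrier)
      have "(B *\<^sub>v (x - y)) $ i = 0" if "i \<in> K" for i
      proof -
        have "i < n"
          using that K(1) by auto
        then have "(B *\<^sub>v (x - y)) $ i = (B *\<^sub>v x) $ i - (B *\<^sub>v y) $ i"
          unfolding mult_mat_vec_minus[OF B c] using B by (subst index_minus_vec) auto
        then show ?thesis
          using mask_eq[OF xy(3) that] by simp
      qed
      then have "x - y = 0\<^sub>v n"
        using ker supp_vecs_minus[OF xy(1,2)] by blast
      then show "x = y"
        using vec_eq_iff_minus[OF c] by simp
    qed
    moreover have "?h ` supp_vecs n K \<subseteq> supp_vecs n K"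
      by (auto simp: supp_vecs_def)
    ultimately have "?h ` supp_vecs n K = supp_vecs n K"
      by (rule endo_inj_surj[OF finite_supp_vecs, rotated])
    moreover have "?mask v \<in> supp_vecs n K"
      by (auto simp: supp_vecs_def)
    ultimately obtain w where "w \<in> supp_vecs n K" "?h w = ?mask v"
      by (metis (no_types, lifting) imageE)
    with mask_eq that show thesis
      by blast
  qed
  have cw: "w \<in> carrier_vec n"
    using w(1) by (rule supp_vecs_carrier)
  define e where "e = v - B *\<^sub>v w"
  have e: "e \<in> carrier_vec n" "\<And>i. i \<in> K \<Longrightarrow> e $ i = 0"
    using v(1) B w K(1) cw by (auto simp: e_def simp del: index_mult_mat_vec)
  have ve: "v = B *\<^sub>v w + e"
    using v(1) B by (intro eq_vecI) (auto simp: e_def)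
  have "v \<noteq> B *\<^sub>v w"
    using v(2) cw B by (auto simp: mat_range_def)
  then obtain j where j: "j < n" "e $ j \<noteq> 0"
    using ve e(1) B by (metis add.right_neutral carrier_vecD eq_vecI index_add_vec(1,2) mult_mat_vec_carrier cw)
  have "j \<notin> K"
    using e(2) j(2) by blast
  define M where "M = insert n (insert j K)"
  have "nonsing_on (border B v a) M"
    unfolding nonsing_on_def
  proof (intro ballI impI)
    let ?A = "border B v a"
    fix z assume z: "z \<in> supp_vecs (dim_col ?A) M" and Az: "\<forall>i\<in>M. (?A *\<^sub>v z) $ i = 0"
    have dim: "dim_col ?A = Suc n"
      using border_carrier[OF B] by blast
    obtain x c where x: "x \<in> carrier_vec n" and zx: "z = snoc_vec x c"
      using snoc_vec_cases[of z n] supp_vecs_carrier[OF z] dim by auto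
    have xs: "x $ i = 0" if "i < n" "i \<notin> insert j K" for i
    proof -
      have "z $ i = 0"
        using z that dim by (auto simp: supp_vecs_def M_def)
      then show ?thesis
        using that x by (simp add: zx snoc_vec_def)
    qed
    note mult = border_mult_snoc_vec[OF B v(1) x, of a c]
    \<comment> \<open>The support of \<open>x\<close> may contain \<open>j\<close>. Nonsingularity
      on \<open>K\<close> is applied through \<open>y\<close>, which has the same image.\<close>
    obtain y where y: "y \<in> supp_vecs n K" "B *\<^sub>v y = B *\<^sub>v x"
      using range x B by (auto simp: mat_range_def set_eq_iff image_iff) metis
    have cy: "y \<in> carrier_vec n"
      using y(1) by (rule supp_vecs_carrier)
    have top: "(B *\<^sub>v x) $ i + c * v $ i = 0" if "i \<in> insert j K" for i
    proof -
      have "i < n"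
        using that K(1) j(1) by auto
      moreover have "(?A *\<^sub>v z) $ i = 0"
        using Az that by (auto simp: M_def)
      ultimately show ?thesis
        using B v(1) x unfolding zx mult by (simp add: snoc_vec_def del: index_mult_mat_vec)
    qed
    have B_add: "B *\<^sub>v (y + c \<cdot>\<^sub>v w) = B *\<^sub>v x + c \<cdot>\<^sub>v (B *\<^sub>v w)"
      using B cy cw y(2) by (simp add: mult_add_distrib_mat_vec[of _ n n] mult_mat_vec[OF B])
    have yw: "y + c \<cdot>\<^sub>v w = 0\<^sub>v n"
    proof (rule ker)
      show "y + c \<cdot>\<^sub>v w \<in> supp_vecs n K"
        using y w by (auto simp: supp_vecs_def)
      fix i assume i: "i \<in> K"
      then have "i < n"
        using K(1) by auto
      then show "(B *\<^sub>v (y + c \<cdot>\<^sub>v w)) $ i = 0"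
        unfolding B_add using top[of i] w(2)[OF i] i B by (simp del: index_mult_mat_vec)
    qed
    moreover have B0: "B *\<^sub>v 0\<^sub>v n = 0\<^sub>v n"
      using B by auto
    ultimately have Bx: "B *\<^sub>v x + c \<cdot>\<^sub>v (B *\<^sub>v w) = 0\<^sub>v n"
      using B_add by metis
    \<comment> \<open>Row \<open>j\<close> of the block has \<open>v $ j\<close> where the relation
      \<open>Bx\<close> has the entry of \<open>B *\<^sub>v w\<close>; the difference of the two
      equations is \<open>c * e $ j\<close>.\<close>
    have "c * e $ j = 0"
    proof -
      have "(B *\<^sub>v x) $ j + c * (B *\<^sub>v w) $ j = 0"
        using arg_cong[OF Bx, of "\<lambda>u. u $ j"] j(1) B by (simp del: index_mult_mat_vec)
      moreover have "v $ j = (B *\<^sub>v w) $ j + e $ j"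
        using arg_cong[OF ve, of "\<lambda>u. u $ j"] j(1) e(1) by (simp del: index_mult_mat_vec)
      ultimately show ?thesis
        using top[of j] by (simp add: algebra_simps del: index_mult_mat_vec)
    qed
    then have c: "c = 0"
      using j(2) by simp
    have "y = 0\<^sub>v n"
      using yw cy cw by (simp add: c vec_eq_iff)
    then have Bx0: "B *\<^sub>v x = 0\<^sub>v n"
      using y(2) B0 by simp
    \<comment> \<open>Only the last row is left. It isolates \<open>x $ j\<close>: the part of
      \<open>v\<close> in the range is orthogonal to the kernel vector \<open>x\<close>, while
      \<open>e\<close> vanishes on \<open>K\<close> and \<open>x\<close> outside
      \<open>insert j K\<close>.\<close>
    have "(?A *\<^sub>v z) $ n = 0"
      using Az by (simp add: M_def)
    then have "v \<bullet> x = 0"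
      using B v(1) x unfolding zx mult by (simp add: snoc_vec_def c del: index_mult_mat_vec)
    moreover have "v \<bullet> x = e \<bullet> x"
    proof -
      have "v \<bullet> x = (B *\<^sub>v w) \<bullet> x + e \<bullet> x"
        using B cw e(1) x by (subst ve) (simp add: add_scalar_prod_distrib[of _ n])
      also have "(B *\<^sub>v w) \<bullet> x = 0"
        using symmetric_mat_scalar_prod[OF B sym cw x] cw by (simp add: Bx0)
      finally show ?thesis
        by simp
    qed
    moreover have "e \<bullet> x = e $ j * x $ j"
    proof -
      have "e \<bullet> x = (\<Sum>i<n. e $ i * x $ i)"
        using x by (simp add: scalar_prod_def atLeast0LessThan)
      also have "\<dots> = (\<Sum>i\<in>{j}. e $ i * x $ i)"
        using j(1) xs e(2) by (intro sum.mono_neutral_right) auto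
      finally show ?thesis
        by simp
    qed
    ultimately have "x $ j = 0"
      using j(2) by simp
    then have "x \<in> supp_vecs n K"
      using xs x by (auto simp: supp_vecs_def)
    then have "x = 0\<^sub>v n"
      using K(1) by (intro ker) (auto simp: Bx0 simp del: index_mult_mat_vec)
    then show "z = 0\<^sub>v (dim_col ?A)"
      unfolding zx c dim by (intro eq_vecI) (auto simp: snoc_vec_def)
  qed
  moreover have "M \<subseteq> {..<Suc n}"
    using K(1) j(1) by (auto simp: M_def)
  ultimately have "card M \<le> vec_space.rank (Suc n) (border B v a)"
    by (intro card_nonsing_on_le_rank[OF border_carrier[OF B]])
  moreover have "card M = card K + 2"
  proof -
    have "finite K" "n \<notin> insert j K"
      using K(1) j(1) by (auto intro: finite_subset)
    then show ?thesis
      using \<open>j \<notin> K\<close> by (simp add: M_def)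
  qed
  ultimately show ?thesis
    using K(3) by simp
qed

section \<open>When a bordered matrix is positive semidefinite\<close>

lemma psd1_border_in_range:
  fixes B :: "'a::{field,finite} mat"
  assumes B: "B \<in> carrier_mat n n" and v: "v \<in> carrier_vec n" and psd: "psd1 (border B v a)"
  shows "v \<in> mat_range B"
proof (rule ccontr)
  assume "v \<notin> mat_range B"
  have "psd1 B"
    using psd psd1_border_iff[OF B] by blast
  then have sym: "transpose_mat B = B"
    by (simp add: psd1_def)
  obtain K where K: "K \<subseteq> {..<Suc n}" "pd1 (principal_submatrix (border B v a) K)"
    "card K = vec_space.rank (Suc n) (border B v a)"
    using psd psd1_border_iff[OF B] by blast
  have "card (K - {n}) \<le> vec_space.rank n B"
    using K(1) by (intro card_pd1_le_rank[OF B] pd1_border_remove[OF B K(1,2)]) (auto simp: less_Suc_eq)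
  moreover have "card K \<le> card (K - {n}) + 1"
    using K(1) by (cases "n \<in> K") (auto simp: card_Suc_Diff1 finite_subset)
  ultimately show False
    using rank_border_not_in_range[OF B sym v \<open>v \<notin> mat_range B\<close>, of a] K(3) by simp
qed

text \<open>The PD_1 blocks of \<open>B\<close> and of the bordered matrix may be unrelated. The
  criterion is still well defined: every full-rank PD_1 block of \<open>B\<close> has a nonzero
  square as determinant and yields the same Schur complement.\<close>

lemma psd1_border_range_iff:
  fixes B :: "'a::{field,finite} mat"
  assumes B: "B \<in> carrier_mat n n" and w: "w \<in> carrier_vec n"
  shows "psd1 (border B (B *\<^sub>v w) a) \<longleftrightarrow>
    psd1 B \<and> (a = w \<bullet> (B *\<^sub>v w) \<or> positive_elem (a - w \<bullet> (B *\<^sub>v w)))"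
    (is "psd1 ?A \<longleftrightarrow> psd1 B \<and> (a = ?t \<or> positive_elem (a - ?t))")
proof (cases "psd1 B")
  case False
  then show ?thesis
    using psd1_border_iff[OF B] by blast
next
  case True
  then have sym: "transpose_mat B = B"
    by (simp add: psd1_def)
  note rank = rank_border[OF B sym w, of a]
  have det_insert: "pd1 (principal_submatrix ?A (insert n K)) \<longleftrightarrow> positive_elem (a - ?t)"
    if K: "K \<subseteq> {..<n}" "pd1 (principal_submatrix B K)" "card K = vec_space.rank n B" for K
  proof -
    note C = principal_submatrix_carrier[OF B K(1)]
    have "nonsing_on B K"
      using invertible_principal_submatrix_iff[OF B K(1)] K(2) invertible_mat_pd1 by blast
    then have "det (principal_submatrix ?A (insert n K)) = det (principal_submatrix B K) * (a - ?t)"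
      by (intro det_principal_submatrix_border_insert[OF B sym w] K)
    then show ?thesis
      using K(2) pd1_positive_det[OF C K(2)]
      by (simp add: principal_submatrix_border_insert[OF B K(1)] pd1_border_iff[OF C]
          positive_elem_mult_iff)
  qed
  obtain K where K: "K \<subseteq> {..<n}" "pd1 (principal_submatrix B K)" "card K = vec_space.rank n B"
    using psd1_obtain_full_rank[OF B True] by blast
  show ?thesis
  proof (cases "a = ?t")
    case True
    then have "pd1 (principal_submatrix ?A K)" "card K = vec_space.rank (Suc n) ?A" "K \<subseteq> {..<Suc n}"
      using K rank by (auto simp: principal_submatrix_border[OF B K(1)])
    then show ?thesis
      using \<open>psd1 B\<close> True psd1_border_iff[OF B] by blast
  next
    case False
    show ?thesis
    proof
      assume "psd1 ?A"
      then obtain L where L: "L \<subseteq> {..<Suc n}" "pd1 (principal_submatrix ?A L)"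
          "card L = vec_space.rank (Suc n) ?A"
        using psd1_border_iff[OF B] by blast
      have L': "L - {n} \<subseteq> {..<n}"
        using L(1) by (auto simp: less_Suc_eq)
      have pd: "pd1 (principal_submatrix B (L - {n}))"
        by (rule pd1_border_remove[OF B L(1,2)])
      have le: "card (L - {n}) \<le> vec_space.rank n B"
        by (rule card_pd1_le_rank[OF B L' pd])
      \<comment> \<open>Without \<open>n\<close>, the block would lie inside \<open>B\<close> and be
        too small for the increased rank.\<close>
      have "n \<in> L"
      proof (rule ccontr)
        assume "n \<notin> L"
        then show False
          using le L(3) rank False by simp
      qed
      then have "L = insert n (L - {n})" "card (L - {n}) = vec_space.rank n B"
        using L(3) rank False L(1) by auto
      then have "positive_elem (a - ?t)"
        using det_insert[OF L' pd] L(2) by simp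
      with \<open>psd1 B\<close> show "psd1 B \<and> (a = ?t \<or> positive_elem (a - ?t))"
        by simp
    next
      assume "psd1 B \<and> (a = ?t \<or> positive_elem (a - ?t))"
      then have "pd1 (principal_submatrix ?A (insert n K))"
        using det_insert[OF K] False by blast
      moreover have "card (insert n K) = vec_space.rank (Suc n) ?A"
        using K(1,3) rank False by (subst card_insert_disjoint) (auto intro: finite_subset)
      moreover have "insert n K \<subseteq> {..<Suc n}"
        using K(1) by auto
      ultimately show "psd1 ?A"
        using \<open>psd1 B\<close> psd1_border_iff[OF B] by blast
    qed
  qed
qed

section \<open>Counting the extensions of a matrix\<close>

text \<open>The corner entry that keeps the rank when \<open>B\<close> is bordered by a vector \<open>v\<close> of its range.\<close>

definition corner :: "'a::semiring_0 mat \<Rightarrow> 'a vec \<Rightarrow> 'a" where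
  "corner B v = (SOME w. w \<in> carrier_vec (dim_col B) \<and> B *\<^sub>v w = v) \<bullet> v"

lemma corner_witness:
  assumes "B \<in> carrier_mat n n" "v \<in> mat_range B"
  obtains w where "w \<in> carrier_vec n" "v = B *\<^sub>v w" "corner B v = w \<bullet> (B *\<^sub>v w)"
proof -
  let ?w = "SOME w. w \<in> carrier_vec (dim_col B) \<and> B *\<^sub>v w = v"
  have "\<exists>w. w \<in> carrier_vec (dim_col B) \<and> B *\<^sub>v w = v"
    using assms(2) by (auto simp: mat_range_def)
  then have "?w \<in> carrier_vec (dim_col B) \<and> B *\<^sub>v ?w = v"
    by (rule someI_ex)
  then show thesis
    using that[of ?w] assms(1) by (simp add: corner_def)
qed

lemma mat_range_carrier: "A \<in> carrier_mat m n \<Longrightarrow> mat_range A \<subseteq> carrier_vec m"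
  by (auto simp: mat_range_def)

text \<open>Measuring the corner entry from \<open>corner B v\<close> separates the conditions on
  \<open>v\<close> and on the offset \<open>d\<close>, so the extensions of \<open>B\<close> are
  parametrized by a product set.\<close>

lemma psd1_border_corner_iff:
  fixes B :: "'a::{field,finite} mat"
  assumes B: "B \<in> carrier_mat n n" and v: "v \<in> carrier_vec n"
  shows "psd1 (border B v (corner B v + d)) \<longleftrightarrow>
    psd1 B \<and> v \<in> mat_range B \<and> (d = 0 \<or> positive_elem d)"
proof (cases "v \<in> mat_range B")
  case True
  then obtain w where w: "w \<in> carrier_vec n" "v = B *\<^sub>v w" "corner B v = w \<bullet> (B *\<^sub>v w)"
    using corner_witness[OF B] by blast
  have "psd1 (border B (B *\<^sub>v w) (w \<bullet> (B *\<^sub>v w) + d)) \<longleftrightarrow> psd1 B \<and> (d = 0 \<or> positive_elem d)"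
    by (subst psd1_border_range_iff[OF B w(1)]) simp
  then show ?thesis
    using True unfolding w(3) unfolding w(2) by simp
next
  \<comment> \<open>Here \<open>corner B v\<close> is unspecified, but no corner entry at all gives
    a positive semidefinite matrix.\<close>
  case False
  then show ?thesis
    using psd1_border_in_range[OF B v] by blast
qed

lemma rank_border_corner:
  fixes B :: "'a::{field,finite} mat"
  assumes B: "B \<in> carrier_mat n n" and sym: "transpose_mat B = B" and v: "v \<in> mat_range B"
  shows "vec_space.rank (Suc n) (border B v (corner B v + d)) =
    vec_space.rank n B + (if d = 0 then 0 else 1)"
proof -
  obtain w where w: "w \<in> carrier_vec n" "v = B *\<^sub>v w" "corner B v = w \<bullet> (B *\<^sub>v w)"
    using corner_witness[OF B v] by blast
  show ?thesis
    unfolding w(3) unfolding w(2) by (simp add: rank_border[OF B sym w(1)])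
qed

definition psd1_mats :: "nat \<Rightarrow> nat \<Rightarrow> 'a::field mat set" where
  "psd1_mats n r = {A. A \<in> carrier_mat n n \<and> psd1 A \<and> vec_space.rank n A = r}"

definition psd1_extensions :: "nat \<Rightarrow> nat \<Rightarrow> 'a set \<Rightarrow> 'a::field mat set" where
  "psd1_extensions n s D = (\<lambda>(B, v, d). border B v (corner B v + d)) `
     (SIGMA B:psd1_mats n s. mat_range B \<times> D)"

text \<open>The case \<open>r = 0\<close> is set apart because the truncated \<open>r - 1\<close>
  would be 0 and bring in extensions of rank 1.\<close>

lemma psd1_mats_Suc:
  "(psd1_mats (Suc n) r :: 'a::{field,finite} mat set) =
     psd1_extensions n r {0} \<union>
     (if r = 0 then {} else psd1_extensions n (r - 1) {d. positive_elem d})"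
    (is "_ = ?R")
proof (intro equalityI subsetI)
  fix A :: "'a mat" assume A: "A \<in> psd1_mats (Suc n) r"
  then have Ac: "A \<in> carrier_mat (Suc n) (Suc n)" and psd: "psd1 A"
    and rk: "vec_space.rank (Suc n) A = r"
    by (auto simp: psd1_mats_def)
  then have "transpose_mat A = A"
    by (simp add: psd1_def)
  then obtain B v a where B: "B \<in> carrier_mat n n" and v: "v \<in> carrier_vec n"
    and A_eq: "A = border B v a"
    using symmetric_border_cases[OF Ac] by blast
  define d where "d = a - corner B v"
  have A': "A = border B v (corner B v + d)"
    by (simp add: A_eq d_def)
  then have *: "psd1 B" "v \<in> mat_range B" "d = 0 \<or> positive_elem d"
    using psd psd1_border_corner_iff[OF B v] by auto
  have rk': "r = vec_space.rank n B + (if d = 0 then 0 else 1)"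
    using rk rank_border_corner[OF B _ *(2), of d] *(1) by (simp add: A' psd1_def)
  then have "B \<in> psd1_mats n (if d = 0 then r else r - 1)"
    using B *(1) by (simp add: psd1_mats_def)
  then show "A \<in> ?R"
    using * rk' A' unfolding psd1_extensions_def
    by (cases "d = 0") (auto intro!: image_eqI[where x = "(B, v, d)"])
next
  fix A :: "'a mat" assume "A \<in> ?R"
  then consider (same) "A \<in> psd1_extensions n r {0}"
    | (incr) "r \<noteq> 0" "A \<in> psd1_extensions n (r - 1) {d. positive_elem d}"
    by (auto split: if_splits)
  then obtain B v d where BR: "B \<in> psd1_mats n (if d = 0 then r else r - 1)" "v \<in> mat_range B"
    and A: "A = border B v (corner B v + d)" and d: "d = 0 \<or> r \<noteq> 0 \<and> positive_elem d"
  proof cases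
    case same
    then obtain B v where "B \<in> psd1_mats n r" "v \<in> mat_range B" "A = border B v (corner B v + 0)"
      by (auto simp: psd1_extensions_def)
    then show thesis
      using that[of B 0 v] by simp
  next
    case incr
    then obtain B v d where "B \<in> psd1_mats n (r - 1)" "v \<in> mat_range B"
        "A = border B v (corner B v + d)" "positive_elem d"
      by (auto simp: psd1_extensions_def)
    then show thesis
      using that[of B d v] positive_elem_nonzero[of d] incr(1) by simp
  qed
  then have B: "B \<in> carrier_mat n n" and psd: "psd1 B"
    and rk: "vec_space.rank n B = (if d = 0 then r else r - 1)"
    by (auto simp: psd1_mats_def)
  have v: "v \<in> carrier_vec n"
    using BR(2) mat_range_carrier[OF B] by blast
  have "psd1 A"
    unfolding A psd1_border_corner_iff[OF B v] using psd BR(2) d by blast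
  moreover have "vec_space.rank (Suc n) A = r"
    unfolding A using rank_border_corner[OF B _ BR(2), of d] rk psd d
    by (auto simp: psd1_def)
  ultimately show "A \<in> psd1_mats (Suc n) r"
    using border_carrier[OF B] by (simp add: psd1_mats_def A)
qed

text \<open>The bordered matrix shows \<open>B\<close> and \<open>v\<close>, hence
  \<open>corner B v\<close>, hence \<open>d\<close>. Letting \<open>d\<close> range over the whole
  field makes the two kinds of extension disjoint by the same injectivity.\<close>

lemma inj_on_border_corner:
  "inj_on (\<lambda>(B, v, d). border B v (corner B v + d))
     (SIGMA B:carrier_mat n n. mat_range B \<times> (UNIV :: 'a::field set))"
  (is "inj_on ?f ?S")
proof (rule inj_onI)
  fix x y assume "x \<in> ?S" "y \<in> ?S" and eq: "?f x = ?f y"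
  then obtain B v d B' v' d' where xy: "x = (B, v, d)" "y = (B', v', d')"
    and B: "B \<in> carrier_mat n n" "B' \<in> carrier_mat n n"
    and "v \<in> mat_range B" "v' \<in> mat_range B'"
    by blast
  then have v: "v \<in> carrier_vec n" "v' \<in> carrier_vec n"
    using mat_range_carrier by blast+
  then show "x = y"
    using eq border_eq_iff[OF B(1) v(1) B(2) v(2)] by (auto simp: xy)
qed

lemma finite_carrier_mat: "finite (carrier_mat m n :: 'a::finite mat set)"
proof (rule finite_subset)
  show "carrier_mat m n \<subseteq> mat m n ` (({..<m} \<times> {..<n}) \<rightarrow>\<^sub>E (UNIV :: 'a set))"
  proof
    fix A :: "'a mat" assume "A \<in> carrier_mat m n"
    then have "A = mat m n (restrict (($$) A) ({..<m} \<times> {..<n}))"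
      by (intro eq_matI) auto
    then show "A \<in> mat m n ` (({..<m} \<times> {..<n}) \<rightarrow>\<^sub>E (UNIV :: 'a set))"
      by (intro image_eqI[where x = "restrict (($$) A) ({..<m} \<times> {..<n})"]) auto
  qed
qed (simp add: finite_PiE)

lemma psd1_mats_subset: "psd1_mats n r \<subseteq> carrier_mat n n"
  by (auto simp: psd1_mats_def)

lemma finite_psd1_mats: "finite (psd1_mats n r :: 'a::{field,finite} mat set)"
  by (rule finite_subset[OF psd1_mats_subset finite_carrier_mat])

lemma card_psd1_extensions:
  "card (psd1_extensions n s D :: 'a::{field,finite} mat set) =
     card (psd1_mats n s :: 'a mat set) * CARD('a) ^ s * card D"
proof -
  let ?S = "SIGMA B:(psd1_mats n s :: 'a mat set). mat_range B \<times> D"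
  have "inj_on (\<lambda>(B, v, d). border B v (corner B v + d)) ?S"
    by (rule inj_on_subset[OF inj_on_border_corner[of n]]) (use psd1_mats_subset in blast)
  then have "card (psd1_extensions n s D) = card ?S"
    by (simp add: psd1_extensions_def card_image)
  also have "\<dots> = (\<Sum>B\<in>(psd1_mats n s :: 'a mat set). card (mat_range B \<times> D))"
    by (rule card_SigmaI) (auto simp: finite_psd1_mats finite_mat_range)
  also have "\<dots> = (\<Sum>B\<in>(psd1_mats n s :: 'a mat set). CARD('a) ^ s * card D)"
    by (rule sum.cong) (auto simp: card_cartesian_product psd1_mats_def card_mat_range)
  finally show ?thesis
    by simp
qed

lemma card_psd1_mats_Suc_0:
  "card (psd1_mats (Suc n) 0 :: 'a::{field,finite} mat set) = card (psd1_mats n 0 :: 'a mat set)"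
  by (simp add: psd1_mats_Suc card_psd1_extensions)

lemma card_psd1_mats_Suc_Suc:
  "card (psd1_mats (Suc n) (Suc r) :: 'a::{field,finite} mat set) =
     card (psd1_mats n (Suc r) :: 'a mat set) * CARD('a) ^ Suc r +
     card (psd1_mats n r :: 'a mat set) * CARD('a) ^ r * card {d :: 'a. positive_elem d}"
proof -
  let ?E = "psd1_extensions n (Suc r) {0 :: 'a}" and ?F = "psd1_extensions n r {d :: 'a. positive_elem d}"
  have "?E \<inter> ?F = {}"
  proof -
    let ?X = "SIGMA B:psd1_mats n (Suc r). mat_range B \<times> {0 :: 'a}"
    let ?Y = "SIGMA B:psd1_mats n r. mat_range B \<times> {d :: 'a. positive_elem d}"
    have "?X \<inter> ?Y = {}"
      by (auto dest: positive_elem_nonzero)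
    moreover have "?X \<subseteq> (SIGMA B:carrier_mat n n. mat_range B \<times> UNIV)"
      "?Y \<subseteq> (SIGMA B:carrier_mat n n. mat_range B \<times> UNIV)"
      using psd1_mats_subset by blast+
    ultimately show ?thesis
      unfolding psd1_extensions_def
      by (subst inj_on_image_Int[OF inj_on_border_corner, symmetric]) auto
  qed
  moreover have "finite ?E" "finite ?F"
    unfolding psd1_extensions_def
    by (intro finite_imageI finite_SigmaI finite_cartesian_product finite_psd1_mats finite_mat_range
        finite)+
  ultimately have "card (?E \<union> ?F) = card ?E + card ?F"
    by (simp add: card_Un_disjoint)
  then show ?thesis
    by (simp add: psd1_mats_Suc card_psd1_extensions)
qed

text \<open>The recursion starts at the empty matrix, where \<open>psd1\<close> has no
  \<open>m\<close> to check.\<close>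

lemma card_psd1_mats_0:
  "card (psd1_mats 0 r :: 'a::{field,finite} mat set) = (if r = 0 then 1 else 0)"
proof -
  have "(psd1_mats 0 r :: 'a mat set) = (if r = 0 then {0\<^sub>m 0 0} else {})"
  proof -
    have "A \<in> psd1_mats 0 r \<longleftrightarrow> A = 0\<^sub>m 0 0 \<and> r = 0" for A :: "'a mat"
    proof -
      have "A \<in> carrier_mat 0 0 \<longleftrightarrow> A = 0\<^sub>m 0 0"
        by (auto intro: eq_matI)
      moreover have "psd1 (0\<^sub>m 0 0 :: 'a mat)"
        by (simp add: psd1_def)
      moreover have "vec_space.rank 0 (0\<^sub>m 0 0 :: 'a mat) = 0"
        using vec_space.rank_le_nc[of "0\<^sub>m 0 0" 0 0] by simp
      ultimately show ?thesis
        by (auto simp: psd1_mats_def)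
    qed
    then show ?thesis
      by auto
  qed
  then show ?thesis
    by simp
qed

section \<open>Pascal's rule for Gaussian binomial coefficients\<close>

lemma gaussian_binomial_0: "gaussian_binomial q n 0 = 1"
  by (simp add: gaussian_binomial_def)

text \<open>The numerator of the factor \<open>i = n\<close> is zero. The closed formula thus also
  covers \<open>r\<close> above \<open>n\<close>, which the induction meets.\<close>

lemma gaussian_binomial_eq_0:
  assumes "n < r"
  shows "gaussian_binomial q n r = 0"
  unfolding gaussian_binomial_def using assms by (intro prod_zero) (auto intro!: bexI[of _ n])

lemma gaussian_binomial_Suc_Suc:
  "gaussian_binomial q (Suc n) (Suc r) =
     (of_nat q ^ Suc n - 1) / (of_nat q ^ Suc r - 1) * gaussian_binomial q n r"
  by (simp add: gaussian_binomial_def prod.lessThan_Suc_shift del: prod.lessThan_Suc power_Suc)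

text \<open>Raising \<open>r\<close> changes every denominator factor, so numerator and denominator
  are treated as separate products; each gains one factor.\<close>

lemma gaussian_binomial_Suc_right:
  "gaussian_binomial q n (Suc r) =
     (of_nat q ^ (n - r) - 1) / (of_nat q ^ Suc r - 1) * gaussian_binomial q n r"
proof -
  let ?d = "\<lambda>r. \<Prod>i<r. of_nat q ^ (r - i) - 1 :: rat"
  have "?d (Suc r) = (of_nat q ^ Suc r - 1) * ?d r"
    by (simp add: prod.lessThan_Suc_shift del: prod.lessThan_Suc power_Suc)
  moreover have "gaussian_binomial q n s = (\<Prod>i<s. of_nat q ^ (n - i) - 1) / ?d s" for s
    by (simp add: gaussian_binomial_def prod_dividef)
  ultimately show ?thesis
    by (simp del: power_Suc)
qed

lemma gaussian_binomial_pascal: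
  assumes "q > 1"
  shows "gaussian_binomial q (Suc n) (Suc r) =
    of_nat q ^ Suc r * gaussian_binomial q n (Suc r) + gaussian_binomial q n r"
proof (cases "r \<le> n")
  case True
  define Q :: rat where "Q = of_nat q"
  have "Q > 1"
    using assms by (simp add: Q_def)
  then have "Q ^ Suc r > 1"
    by (rule one_less_power) simp
  then have "Q ^ Suc r - 1 \<noteq> 0"
    by simp
  \<comment> \<open>With \<open>x\<close> = q^(r+1) and \<open>y\<close> = q^(n-r), this is Pascal's
    rule after division by the common factor \<open>gaussian_binomial q n r\<close>.\<close>
  moreover have "(x * y - 1) / (x - 1) = x * ((y - 1) / (x - 1)) + 1" if "x - 1 \<noteq> 0" for x y :: rat
    using that by (simp add: field_simps)
  moreover have "Q ^ Suc n = Q ^ Suc r * Q ^ (n - r)"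
    using True by (simp flip: power_add)
  ultimately have "(Q ^ Suc n - 1) / (Q ^ Suc r - 1) =
      Q ^ Suc r * ((Q ^ (n - r) - 1) / (Q ^ Suc r - 1)) + 1"
    by metis
  then show ?thesis
    by (simp only: gaussian_binomial_Suc_Suc[of q n r] gaussian_binomial_Suc_right[of q n r] Q_def
        distrib_right mult_1_left mult.assoc)
next
  case False
  then show ?thesis
    by (simp add: gaussian_binomial_eq_0)
qed

section \<open>The number of positive elements\<close>

lemma card_eq_twice_card_image:
  assumes "finite A" "\<And>x. x \<in> A \<Longrightarrow> card {y \<in> A. f y = f x} = 2"
  shows "card A = 2 * card (f ` A)"
proof -
  have "card A = (\<Sum>z\<in>f ` A. card {y \<in> A. f y = z})"
    using sum.image_gen[OF assms(1), of "\<lambda>_. 1 :: nat" f] by simp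
  also have "\<dots> = (\<Sum>z\<in>f ` A. 2)"
    by (rule sum.cong) (auto simp: assms(2))
  finally show ?thesis
    by simp
qed

lemma positive_elem_set_eq: "{a :: 'a::field. positive_elem a} = (\<lambda>x. x ^ 2) ` (- {0})"
  by (auto simp: positive_elem_def)

lemma card_nonzero: "card (- {0 :: 'a::{field,finite}}) = CARD('a) - 1"
  by (simp add: Compl_eq_Diff_UNIV card_Diff_singleton)

text \<open>The fibres of squaring on the nonzero elements are the pairs x, -x, which are distinct
  here.\<close>

lemma card_positive_elem_char_not_2:
  assumes "(2 :: 'a::{field,finite}) \<noteq> 0"
  shows "CARD('a) = 2 * card {a :: 'a. positive_elem a} + 1"
proof -
  have "card {y \<in> - {0}. y ^ 2 = x ^ 2} = 2" if "x \<in> - {0}" for x :: 'a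
  proof -
    have "x + x \<noteq> 0"
      using assms that by (simp flip: mult_2)
    then have "x \<noteq> - x"
      by (metis add.right_inverse)
    moreover have "{y \<in> - {0}. y ^ 2 = x ^ 2} = {x, - x}"
      using that by (auto simp: power2_eq_iff)
    ultimately show ?thesis
      by simp
  qed
  then have "card (- {0 :: 'a}) = 2 * card {a :: 'a. positive_elem a}"
    unfolding positive_elem_set_eq by (intro card_eq_twice_card_image) auto
  then show ?thesis
    using one_less_card_field[where 'a = 'a] by (simp add: card_nonzero)
qed

text \<open>Since -x = x, squaring is injective and every nonzero element is a square.\<close>

lemma card_positive_elem_char_2:
  assumes "(2 :: 'a::{field,finite}) = 0"
  shows "card {a :: 'a. positive_elem a} = CARD('a) - 1"
proof -
  have "- x = x" for x :: 'a
    using assms by (metis add.inverse_unique mult_2 mult_zero_left)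
  then have "inj_on (\<lambda>x :: 'a. x ^ 2) (- {0})"
    by (auto simp: inj_on_def power2_eq_iff)
  then show ?thesis
    by (simp add: positive_elem_set_eq card_image card_nonzero)
qed

text \<open>In characteristic 2 the map \<open>x \<mapsto> x\<^sup>2 + x\<close> has the two-element fibres \<open>{x, x + 1}\<close>.\<close>

lemma even_card_char_2:
  assumes "(2 :: 'a::{field,finite}) = 0"
  shows "even CARD('a)"
proof -
  have neg: "- x = x" for x :: 'a
    using assms by (metis add.inverse_unique mult_2 mult_zero_left)
  have "card {y \<in> UNIV. y ^ 2 + y = x ^ 2 + x} = 2" for x :: 'a
  proof -
    have "y ^ 2 + y = x ^ 2 + x \<longleftrightarrow> y = x \<or> y = x + 1" for y
    proof -
      have "y ^ 2 + y = x ^ 2 + x \<longleftrightarrow> (y - x) * (y - - (x + 1)) = 0"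
        by (simp add: power2_eq_square algebra_simps)
      then show ?thesis
        unfolding neg by simp
    qed
    then have "{y \<in> UNIV. y ^ 2 + y = x ^ 2 + x} = {x, x + 1}"
      by auto
    then show ?thesis
      by simp
  qed
  then show ?thesis
    using card_eq_twice_card_image[of UNIV "\<lambda>x :: 'a. x ^ 2 + x"] by simp
qed

text \<open>The formula splits by the parity of q, the counts by whether 2 = 0 in the field. If 2 =
  0, then q is even; otherwise the count writes q as twice a number plus 1.\<close>

lemma card_positive_elem:
  "(of_nat (card {a :: 'a::{field,finite}. positive_elem a}) :: rat) =
    (if odd CARD('a) then (of_nat CARD('a) - 1) / 2 else of_nat CARD('a) - 1)"
proof (cases "(2 :: 'a) = 0")
  case True
  then show ?thesis
    using one_less_card_field[where 'a = 'a]
    by (simp add: card_positive_elem_char_2 even_card_char_2 of_nat_diff)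
next
  case False
  then have q: "CARD('a) = 2 * card {a :: 'a. positive_elem a} + 1"
    by (rule card_positive_elem_char_not_2)
  then have "odd CARD('a)"
    by simp
  moreover have "(of_nat CARD('a) :: rat) = 2 * of_nat (card {a :: 'a. positive_elem a}) + 1"
    by (subst q) simp
  ultimately show ?thesis
    by simp
qed

section \<open>The closed formula\<close>

lemma of_nat_card_psd1_mats:
  "(of_nat (card (psd1_mats n r :: 'a::{field,finite} mat set)) :: rat) =
    gaussian_binomial CARD('a) n r * of_nat CARD('a) ^ (r * (r - 1) div 2) *
      of_nat (card {a :: 'a. positive_elem a}) ^ r"
proof (induction n arbitrary: r)
  case 0
  then show ?case
    by (simp add: card_psd1_mats_0 gaussian_binomial_0 gaussian_binomial_eq_0)
next
  case (Suc n)
  show ?case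
  proof (cases r)
    case 0
    then show ?thesis
      using Suc.IH[of 0] by (simp add: card_psd1_mats_Suc_0 gaussian_binomial_0)
  next
    case (Suc s)
    define Q :: rat where "Q = of_nat CARD('a)"
    define p :: rat where "p = of_nat (card {a :: 'a. positive_elem a})"
    \<comment> \<open>The summand \<open>s\<close> absorbs the factor q^s that counts the bordering
      vectors for a matrix of rank \<open>s\<close>. For \<open>s = 0\<close> the subtraction is
      truncated and both sides are 0.\<close>
    have exp: "Suc s * (Suc s - 1) div 2 = s + s * (s - 1) div 2"
    proof (cases s)
      case (Suc t)
      have "Suc (Suc t) * Suc t = 2 * Suc t + Suc t * t"
        by simp
      then show ?thesis
        unfolding Suc by (simp del: mult_Suc mult_Suc_right)
    qed simp
    have "of_nat (card (psd1_mats (Suc n) (Suc s) :: 'a mat set)) =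
        gaussian_binomial CARD('a) n (Suc s) * Q ^ (Suc s * (Suc s - 1) div 2) * p ^ Suc s * Q ^ Suc s +
        gaussian_binomial CARD('a) n s * Q ^ (s * (s - 1) div 2) * p ^ s * Q ^ s * p"
      using Suc.IH[of "Suc s"] Suc.IH[of s] by (simp add: card_psd1_mats_Suc_Suc Q_def p_def)
    also have "\<dots> = (Q ^ Suc s * gaussian_binomial CARD('a) n (Suc s) + gaussian_binomial CARD('a) n s) *
        Q ^ (s + s * (s - 1) div 2) * p ^ Suc s"
      unfolding exp by (simp add: power_add algebra_simps)
    also have "\<dots> = gaussian_binomial CARD('a) (Suc n) (Suc s) *
        Q ^ (Suc s * (Suc s - 1) div 2) * p ^ Suc s"
      unfolding exp gaussian_binomial_pascal[OF one_less_card_field[where 'a = 'a]] Q_def ..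
    finally show ?thesis
      by (simp add: \<open>r = Suc s\<close> Q_def p_def)
  qed
qed

theorem corollary4p6:
  fixes q n r :: nat
  assumes "CARD('a::{field,finite}) = q"
    and "n \<ge> 1"
    and "r \<le> n"
  shows "of_nat (psd1_count TYPE('a) n r) =
    (if odd q
     then gaussian_binomial q n r * of_nat q ^ (r * (r - 1) div 2) * ((of_nat q - 1) / 2) ^ r
     else gaussian_binomial q n r * of_nat q ^ (r * (r - 1) div 2) * (of_nat q - 1) ^ r)"
proof -
  have "psd1_count TYPE('a) n r = card (psd1_mats n r :: 'a mat set)"
    by (simp add: psd1_count_def psd1_mats_def)
  then show ?thesis
    by (simp only: of_nat_card_psd1_mats card_positive_elem assms(1) split: if_split) simp
qed

end
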